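(* Let $p$ be a symmetric nc polynomial in $g$ symmetric variables, let $\mathcal{O}$ be an nc basic open semialgebraic set and let $\mathcal{R}$ denote the set of full rank points $(X,v)$ of $p$ in $\mathcal{V}(p)$ with $X\in\mathcal{O}$. If (1) $\mathcal{R}$ is nonempty; (2) $\mathcal{V}(p)$ has positive curvature at each point of $\mathcal{R}$; and (3) $p$ is a minimum degree defining polynomial for $\mathcal{R}$, then $\deg(p)$ is at most two and $p$ is concave.
   Context: $\mathbb{R}\langle x\rangle$ is the free associative $\mathbb{R}$-algebra in noncommuting variables $x=(x_1,\dots,x_g)$, with linear involution ${}^\intercal$ reversing words ($x_j^\intercal=x_j$); its elements are nc polynomials; $p$ is symmetric if $p^\intercal=p$; the degree is the length of the longest word appearing. $\mathbb{S}^{n\times n}$ denotes the real symmetric $n\times n$ matrices; $p(X)$ for $X\in(\mathbb{S}^{n\times n})^g$ is obtained by substituting $X_j$ for $x_j$. Derivatives: $p'(X)[H]=\frac{d}{dt}p(X+tH)|_{t=0}$ and $p''(X)[H]=\frac{d^2}{dt^2}p(X+tH)|_{t=0}$ for $X,H\in(\mathbb{S}^{n\times n})^g$. An nc basic open semialgebraic set is a sequence $\mathcal{O}=(\mathcal{O}(n))_n$, $\mathcal{O}(n)=\{X\in(\mathbb{S}^{n\times n})^g: p_1(X)\succ0,\dots,p_k(X)\succ0\}$ for fixed symmetric nc polynomials $p_1,\dots,p_k$; $X\in\mathcal{O}$ means $X\in\mathcal{O}(n)$ for some $n$. The variety of $p$ is $\mathcal{V}(p)=\bigcup_{n\ge1}\mathcal{V}_n(p)$,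 $\mathcal{V}_n(p)=\{(X,v)\in(\mathbb{S}^{n\times n})^g\times\mathbb{R}^n: p(X)v=0\}$. A point $(X,v)\in\mathcal{V}_n(p)$ is a full rank point of $p$ if the map $(\mathbb{S}^{n\times n})^g\to\mathbb{R}^n$, $H\mapsto p'(X)[H]v$, is onto. The clamped tangent plane at $(X,v)\in\mathcal{V}_n(p)$ is $\mathcal{T}_p(X,v)=\{H\in(\mathbb{S}^{n\times n})^g: p'(X)[H]v=0\}$. $\mathcal{V}(p)$ has positive curvature at $(X,v)\in\mathcal{V}(p)$ if $-\langle p''(X)[H]v,v\rangle\ge0$ for every $H\in\mathcal{T}_p(X,v)$. A symmetric nc polynomial $p$ is a minimum degree defining polynomial for a nonempty set $\mathcal{D}\subseteq\mathcal{V}(p)$ if whenever $q\neq0$ is another (not necessarily symmetric) nc polynomial with $q(X)v=0$ for each $(X,v)\in\mathcal{D}$, then $\deg(q)\ge\deg(p)$. $p$ is concave if $-p$ is matrix convex, i.e. for every $n$, $X,Y\in(\mathbb{S}^{n\times n})^g$ and $0\le t\le1$, the matrix $p(tX+(1-t)Y)-tp(X)-(1-t)p(Y)$ is positive semidefinite. *)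

theory Defs
  imports
    "HOL-Analysis.Derivative"
    "HOL-Library.Poly_Mapping"
    "Jordan_Normal_Form.Matrix"
begin

hide_const (open) Poly_Mapping.degree

(* An element of the free algebra is its finitely supported family of real coefficients,
   indexed by the words (lists) in the letters 'g.  The number g of variables is CARD('g).
   The list [i, j, k] is the word x_i x_j x_k and [] is the unit.  The algebra product
   is not needed below. *)
type_synonym 'g ncpoly = "'g list \<Rightarrow>\<^sub>0 real"

definition nc_transpose :: "'g ncpoly \<Rightarrow> 'g ncpoly" where
  "nc_transpose p = Poly_Mapping.map_key rev p"

definition nc_symmetric :: "'g ncpoly \<Rightarrow> bool" where
  "nc_symmetric p \<longleftrightarrow> nc_transpose p = p"

(* The zero polynomial gets degree 0. *)
definition nc_degree :: "'g ncpoly \<Rightarrow> nat" where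
  "nc_degree p = Max (insert 0 (length ` Poly_Mapping.keys p))"

(* The type of matrices contains all sizes, so the common size n of a tuple (a function on
   the letters) is an explicit argument. *)
definition sym_tuples :: "nat \<Rightarrow> ('g \<Rightarrow> real mat) set" where
  "sym_tuples n = {X. \<forall>j. X j \<in> carrier_mat n n \<and> transpose_mat (X j) = X j}"

definition word_eval :: "nat \<Rightarrow> ('g \<Rightarrow> real mat) \<Rightarrow> 'g list \<Rightarrow> real mat" where
  "word_eval n X w = foldr (\<lambda>j M. X j * M) w (1\<^sub>m n)"

(* Written entrywise because the type of matrices of all sizes has no big sums. *)
definition nc_eval :: "nat \<Rightarrow> 'g ncpoly \<Rightarrow> ('g \<Rightarrow> real mat) \<Rightarrow> real mat" where
  "nc_eval n p X =
     mat n n (\<lambda>(i, j). \<Sum>w\<in>Poly_Mapping.keys p. Poly_Mapping.lookup p w * word_eval n X w $$ (i, j))"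

definition tuple_line :: "('g \<Rightarrow> real mat) \<Rightarrow> ('g \<Rightarrow> real mat) \<Rightarrow> real \<Rightarrow> 'g \<Rightarrow> real mat" where
  "tuple_line X H t = (\<lambda>j. X j + t \<cdot>\<^sub>m H j)"

(* The t-derivatives of the matrix p(X + tH) at t = 0 are taken entrywise; every entry is
   a polynomial in t. *)
definition nc_deriv :: "nat \<Rightarrow> 'g ncpoly \<Rightarrow> ('g \<Rightarrow> real mat) \<Rightarrow> ('g \<Rightarrow> real mat) \<Rightarrow> real mat" where
  "nc_deriv n p X H =
     mat n n (\<lambda>(i, j). deriv (\<lambda>t. nc_eval n p (tuple_line X H t) $$ (i, j)) 0)"

definition nc_deriv2 :: "nat \<Rightarrow> 'g ncpoly \<Rightarrow> ('g \<Rightarrow> real mat) \<Rightarrow> ('g \<Rightarrow> real mat) \<Rightarrow> real mat" where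
  "nc_deriv2 n p X H =
     mat n n (\<lambda>(i, j). (deriv ^^ 2) (\<lambda>t. nc_eval n p (tuple_line X H t) $$ (i, j)) 0)"

definition pos_def :: "nat \<Rightarrow> real mat \<Rightarrow> bool" where
  "pos_def n A \<longleftrightarrow> A \<in> carrier_mat n n \<and> transpose_mat A = A \<and>
     (\<forall>v\<in>carrier_vec n. v \<noteq> 0\<^sub>v n \<longrightarrow> scalar_prod (A *\<^sub>v v) v > 0)"

definition pos_semidef :: "nat \<Rightarrow> real mat \<Rightarrow> bool" where
  "pos_semidef n A \<longleftrightarrow> A \<in> carrier_mat n n \<and> transpose_mat A = A \<and>
     (\<forall>v\<in>carrier_vec n. scalar_prod (A *\<^sub>v v) v \<ge> 0)"

(* Only the sizes n \<ge> 1 are meaningful: the value at 0 is left unconstrained. *)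
definition nc_basic_open_semialgebraic :: "(nat \<Rightarrow> ('g \<Rightarrow> real mat) set) \<Rightarrow> bool" where
  "nc_basic_open_semialgebraic \<O> \<longleftrightarrow>
     (\<exists>ps :: 'g ncpoly list. (\<forall>q\<in>set ps. nc_symmetric q) \<and>
        (\<forall>n\<ge>1. \<O> n = {X \<in> sym_tuples n. \<forall>q\<in>set ps. pos_def n (nc_eval n q X)}))"

definition nc_variety_at :: "'g ncpoly \<Rightarrow> nat \<Rightarrow> (('g \<Rightarrow> real mat) \<times> real Matrix.vec) set" where
  "nc_variety_at p n =
     {(X, v). X \<in> sym_tuples n \<and> v \<in> carrier_vec n \<and> nc_eval n p X *\<^sub>v v = 0\<^sub>v n}"

definition nc_variety :: "'g ncpoly \<Rightarrow> (('g \<Rightarrow> real mat) \<times> real Matrix.vec) set" where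
  "nc_variety p = (\<Union>n\<in>{1..}. nc_variety_at p n)"

(* For a point (X, v) of the variety, the size n is recovered as dim_vec v. *)
definition full_rank_point ::
  "'g ncpoly \<Rightarrow> ('g \<Rightarrow> real mat) \<times> real Matrix.vec \<Rightarrow> bool" where
  "full_rank_point p = (\<lambda>(X, v). (X, v) \<in> nc_variety p \<and>
     (\<lambda>H. nc_deriv (dim_vec v) p X H *\<^sub>v v) ` sym_tuples (dim_vec v) = carrier_vec (dim_vec v))"

definition clamped_tangent ::
  "'g ncpoly \<Rightarrow> ('g \<Rightarrow> real mat) \<Rightarrow> real Matrix.vec \<Rightarrow> ('g \<Rightarrow> real mat) set" where
  "clamped_tangent p X v =
     {H \<in> sym_tuples (dim_vec v). nc_deriv (dim_vec v) p X H *\<^sub>v v = 0\<^sub>v (dim_vec v)}"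

definition positive_curvature_at ::
  "'g ncpoly \<Rightarrow> ('g \<Rightarrow> real mat) \<times> real Matrix.vec \<Rightarrow> bool" where
  "positive_curvature_at p = (\<lambda>(X, v). (X, v) \<in> nc_variety p \<and>
     (\<forall>H\<in>clamped_tangent p X v. - scalar_prod (nc_deriv2 (dim_vec v) p X H *\<^sub>v v) v \<ge> 0))"

definition full_rank_points_in ::
  "'g ncpoly \<Rightarrow> (nat \<Rightarrow> ('g \<Rightarrow> real mat) set) \<Rightarrow> (('g \<Rightarrow> real mat) \<times> real Matrix.vec) set" where
  "full_rank_points_in p \<O> = {(X, v). full_rank_point p (X, v) \<and> (\<exists>n\<ge>1. X \<in> \<O> n)}"

definition min_degree_defining ::
  "'g ncpoly \<Rightarrow> (('g \<Rightarrow> real mat) \<times> real Matrix.vec) set \<Rightarrow> bool" where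
  "min_degree_defining p D \<longleftrightarrow>
     nc_symmetric p \<and> D \<noteq> {} \<and> D \<subseteq> nc_variety p \<and>
     (\<forall>q. q \<noteq> 0 \<and> (\<forall>(X, v)\<in>D. nc_eval (dim_vec v) q X *\<^sub>v v = 0\<^sub>v (dim_vec v))
        \<longrightarrow> nc_degree q \<ge> nc_degree p)"

definition nc_concave :: "'g ncpoly \<Rightarrow> bool" where
  "nc_concave p \<longleftrightarrow>
     (\<forall>n\<ge>1. \<forall>X\<in>sym_tuples n. \<forall>Y\<in>sym_tuples n. \<forall>t::real. 0 \<le> t \<and> t \<le> 1 \<longrightarrow>
        pos_semidef n (nc_eval n p (\<lambda>j. t \<cdot>\<^sub>m X j + (1 - t) \<cdot>\<^sub>m Y j)
          - t \<cdot>\<^sub>m nc_eval n p X - (1 - t) \<cdot>\<^sub>m nc_eval n p Y))"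

end

theory Submission
  imports Defs
begin

text \<open>
  Let \<open>d\<close> be the degree of \<open>p\<close>. The argument exhibits, at one suitable full rank point, a tangent
  direction along which the Hessian is positive, unless \<open>d \<le> 2\<close> and the quadratic part of \<open>p\<close> is
  negative semidefinite.

  The full rank points in \<open>\<O>\<close> are closed under direct sums (\<open>full_rank_points_in_dsum\<close>). Since \<open>p\<close>
  has minimal degree, no nonzero polynomial of degree less than \<open>d\<close> annihilates all of them, so some
  direct sum \<open>(X, v)\<close> has the property that the vectors \<open>c(X) v\<close>, for words \<open>c\<close> of length less than
  \<open>d\<close>, are linearly independent (\<open>exists_independent_point\<close>). Replacing \<open>(X, v)\<close> by
  \<open>(X \<oplus> X, v \<oplus> v)\<close> gives, moreover, a nonzero vector \<open>y = v \<oplus> -v\<close> that is orthogonal to every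
  \<open>w(X) v\<close>.

  The derivatives \<open>p'(X)[H] v\<close> and \<open>\<langle>p''(X)[H] v, v\<rangle>\<close> depend on \<open>H\<close> only through the vectors
  \<open>H\<^sub>i c(X) v\<close>. A symmetric \<open>H\<close> can be chosen with arbitrary values of these vectors in the
  orthogonal complement of all \<open>w(X) v\<close> (\<open>symmetric_interpolation\<close>). The point of the proof is
  that the words \<open>c\<close> of length \<open>d - 1\<close> occur in \<open>p'\<close> but not in \<open>p''\<close>: they can be used to satisfy
  the tangency condition, whatever is prescribed on the shorter words. Prescribing \<open>\<gamma>(i, c) y\<close> there,
  positive curvature says that an explicit quadratic form in the free parameters \<open>\<gamma>(i, c)\<close> is
  nonpositive (\<open>curvature_split_form_nonpos\<close>).

  If \<open>d \<ge> 3\<close>, this form has zero diagonal entries at the parameters \<open>\<gamma>(j, c)\<close> with \<open>c\<close> of length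
  \<open>d - 2\<close>. A word \<open>x\<^sub>i x\<^sub>j c\<close> in the leading part of \<open>p\<close> gives a nonzero entry between such a
  \<open>\<gamma>(j, c)\<close> and \<open>\<gamma>(i, [])\<close>, so the form is indefinite (\<open>nonpos_split_form_degree_le_2\<close>). If \<open>d = 2\<close>,
  it is a positive multiple of the quadratic part of \<open>p\<close>, and semidefiniteness of the latter is
  concavity (\<open>quadratic_nc_concave\<close>).
\<close>

unbundle no inner_syntax and no vec_syntax

section \<open>Words in matrices and their derivatives\<close>

text \<open>The values of \<open>p\<close> and of its first and second directional derivatives are all of the form
  \<open>\<Sum>\<^sub>w p\<^sub>w F(w)\<close> with a matrix \<open>F(w)\<close> attached to each word, so that linearity, compatibility
  with direct sums and the action on vectors need to be checked only once.\<close>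

definition wsum :: "nat \<Rightarrow> 'g ncpoly \<Rightarrow> ('g list \<Rightarrow> real mat) \<Rightarrow> real mat" where
  "wsum n p F = mat n n (\<lambda>(i, j). \<Sum>w\<in>Poly_Mapping.keys p. Poly_Mapping.lookup p w * F w $$ (i, j))"

lemma wsum_carrier [simp]: "wsum n p F \<in> carrier_mat n n"
  by (simp add: wsum_def)

lemma nc_eval_eq_wsum: "nc_eval n p X = wsum n p (word_eval n X)"
  by (simp add: nc_eval_def wsum_def)

lemma wsum_mult_vec:
  assumes F: "\<And>w. w \<in> Poly_Mapping.keys p \<Longrightarrow> F w \<in> carrier_mat n n"
    and v: "v \<in> carrier_vec n" and i: "i < n"
  shows "(wsum n p F *\<^sub>v v) $ i = (\<Sum>w\<in>Poly_Mapping.keys p. Poly_Mapping.lookup p w * (F w *\<^sub>v v) $ i)"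
proof -
  have "(wsum n p F *\<^sub>v v) $ i = (\<Sum>j=0..<n. (\<Sum>w\<in>Poly_Mapping.keys p. Poly_Mapping.lookup p w * F w $$ (i, j)) * v $ j)"
    using v i by (simp add: wsum_def scalar_prod_def)
  also have "\<dots> = (\<Sum>w\<in>Poly_Mapping.keys p. Poly_Mapping.lookup p w * (\<Sum>j=0..<n. F w $$ (i, j) * v $ j))"
    by (subst sum_distrib_left, subst sum.swap) (simp add: sum_distrib_right mult.assoc)
  also have "\<dots> = (\<Sum>w\<in>Poly_Mapping.keys p. Poly_Mapping.lookup p w * (F w *\<^sub>v v) $ i)"
  proof (rule sum.cong[OF refl])
    fix w assume "w \<in> Poly_Mapping.keys p"
    from F[OF this] v i show "Poly_Mapping.lookup p w * (\<Sum>j=0..<n. F w $$ (i, j) * v $ j) =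
      Poly_Mapping.lookup p w * (F w *\<^sub>v v) $ i"
      by (simp add: scalar_prod_def)
  qed
  finally show ?thesis .
qed

lemma wsum_scalar_prod:
  assumes F: "\<And>w. w \<in> Poly_Mapping.keys p \<Longrightarrow> F w \<in> carrier_mat n n"
    and v: "v \<in> carrier_vec n" and u: "u \<in> carrier_vec n"
  shows "scalar_prod (wsum n p F *\<^sub>v v) u =
    (\<Sum>w\<in>Poly_Mapping.keys p. Poly_Mapping.lookup p w * scalar_prod (F w *\<^sub>v v) u)"
proof -
  have "scalar_prod (wsum n p F *\<^sub>v v) u = (\<Sum>i=0..<n. (wsum n p F *\<^sub>v v) $ i * u $ i)"
    using u by (simp add: scalar_prod_def)
  also have "\<dots> = (\<Sum>i=0..<n. (\<Sum>w\<in>Poly_Mapping.keys p. Poly_Mapping.lookup p w * (F w *\<^sub>v v) $ i) * u $ i)"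
    by (rule sum.cong[OF refl]) (simp add: wsum_mult_vec[OF F v] del: index_mult_mat_vec)
  also have "\<dots> = (\<Sum>w\<in>Poly_Mapping.keys p. Poly_Mapping.lookup p w * (\<Sum>i=0..<n. (F w *\<^sub>v v) $ i * u $ i))"
    by (subst sum_distrib_left, subst sum.swap) (simp add: sum_distrib_right mult.assoc)
  also have "\<dots> = (\<Sum>w\<in>Poly_Mapping.keys p. Poly_Mapping.lookup p w * scalar_prod (F w *\<^sub>v v) u)"
    using u by (simp add: scalar_prod_def[of _ u])
  finally show ?thesis .
qed

lemma word_eval_Nil [simp]: "word_eval n X [] = 1\<^sub>m n"
  and word_eval_Cons [simp]: "word_eval n X (j # w) = X j * word_eval n X w"
  by (simp_all add: word_eval_def)

lemma sym_tuples_carrier: "X \<in> sym_tuples n \<Longrightarrow> X j \<in> carrier_mat n n"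
  and sym_tuples_transpose: "X \<in> sym_tuples n \<Longrightarrow> transpose_mat (X j) = X j"
  by (simp_all add: sym_tuples_def)

lemma word_eval_carrier [simp]:
  assumes "X \<in> sym_tuples n" shows "word_eval n X w \<in> carrier_mat n n"
  using assms by (induction w) (auto intro!: mult_carrier_mat simp: sym_tuples_carrier)

lemma word_eval_append:
  assumes "X \<in> sym_tuples n"
  shows "word_eval n X (u @ w) = word_eval n X u * word_eval n X w"
  using assms
  by (induction u)
    (auto simp: sym_tuples_carrier assoc_mult_mat[of _ n n _ n _ n] left_mult_one_mat[of _ n n])

lemma word_eval_transpose:
  assumes X: "X \<in> sym_tuples n"
  shows "transpose_mat (word_eval n X w) = word_eval n X (rev w)"
proof (induction w)
  case (Cons j w)
  have "transpose_mat (word_eval n X (j # w)) = transpose_mat (word_eval n X w) * transpose_mat (X j)"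
    using X by (simp add: transpose_mult[of _ n n _ n] sym_tuples_carrier)
  also have "\<dots> = word_eval n X (rev w) * X j"
    using Cons X by (simp add: sym_tuples_transpose)
  finally show ?case
    using X by (simp add: word_eval_append right_mult_one_mat[of _ n n] sym_tuples_carrier)
qed simp

lemma word_eval_adjoint:
  assumes X: "X \<in> sym_tuples n" and v: "v \<in> carrier_vec n" and u: "u \<in> carrier_vec n"
  shows "scalar_prod (word_eval n X w *\<^sub>v v) u = scalar_prod v (word_eval n X (rev w) *\<^sub>v u)"
  using transpose_vec_mult_scalar[of "word_eval n X (rev w)" n n u v] assms
  by (simp add: word_eval_transpose)

lemma sym_adjoint:
  assumes X: "X \<in> sym_tuples n" and v: "v \<in> carrier_vec n" and u: "u \<in> carrier_vec n"
  shows "scalar_prod (X j *\<^sub>v v) u = scalar_prod v (X j *\<^sub>v u)"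
  using transpose_vec_mult_scalar[of "X j" n n u v] assms
  by (simp add: sym_tuples_transpose sym_tuples_carrier)

lemma tuple_line_sym_tuples:
  assumes "X \<in> sym_tuples n" "H \<in> sym_tuples n"
  shows "tuple_line X H t \<in> sym_tuples n"
proof -
  have "transpose_mat (t \<cdot>\<^sub>m H j) = t \<cdot>\<^sub>m transpose_mat (H j)" for j
    by (rule eq_matI) auto
  then show ?thesis
    using assms unfolding sym_tuples_def tuple_line_def
    by (auto simp: transpose_add[of _ n n])
qed

text \<open>The Leibniz rule, letter by letter; the factor 2 in the second derivative counts the two orders
  in which \<open>x\<^sub>j\<close> and a later letter can be replaced.\<close>

fun word_deriv :: "nat \<Rightarrow> ('g \<Rightarrow> real mat) \<Rightarrow> ('g \<Rightarrow> real mat) \<Rightarrow> 'g list \<Rightarrow> real mat" where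
  "word_deriv n X H [] = 0\<^sub>m n n"
| "word_deriv n X H (j # w) = H j * word_eval n X w + X j * word_deriv n X H w"

fun word_deriv2 :: "nat \<Rightarrow> ('g \<Rightarrow> real mat) \<Rightarrow> ('g \<Rightarrow> real mat) \<Rightarrow> 'g list \<Rightarrow> real mat" where
  "word_deriv2 n X H [] = 0\<^sub>m n n"
| "word_deriv2 n X H (j # w) =
     2 \<cdot>\<^sub>m (H j * word_deriv n X H w) + X j * word_deriv2 n X H w"

lemma word_deriv_carrier [simp]:
  assumes "X \<in> sym_tuples n" "H \<in> sym_tuples n" shows "word_deriv n X H w \<in> carrier_mat n n"
  using assms
  by (induction w) (auto intro!: mult_carrier_mat add_carrier_mat simp: sym_tuples_carrier)

lemma word_deriv2_carrier [simp]:
  assumes "X \<in> sym_tuples n" "H \<in> sym_tuples n" shows "word_deriv2 n X H w \<in> carrier_mat n n"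
  using assms
  by (induction w) (auto intro!: mult_carrier_mat add_carrier_mat simp: sym_tuples_carrier)

text \<open>The product rule for a line \<open>A + t C\<close> times a differentiable matrix function, entry by entry.
  It is the only differentiation step that the induction on words uses.\<close>

lemma has_field_derivative_line_mult:
  fixes B :: "real \<Rightarrow> real mat"
  assumes A: "A \<in> carrier_mat n n" and C: "C \<in> carrier_mat n n"
    and B: "\<And>t. B t \<in> carrier_mat n n" and B': "B' \<in> carrier_mat n n"
    and der: "\<And>l. l < n \<Longrightarrow> ((\<lambda>t. B t $$ (l, k)) has_field_derivative B' $$ (l, k)) (at t)"
    and i: "i < n" and k: "k < n"
  shows "((\<lambda>t. ((A + t \<cdot>\<^sub>m C) * B t) $$ (i, k)) has_field_derivative
           (C * B t + (A + t \<cdot>\<^sub>m C) * B') $$ (i, k)) (at t)"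
proof -
  have prod: "((A + s \<cdot>\<^sub>m C) * D) $$ (i, k) = (\<Sum>l=0..<n. (A $$ (i, l) + s * C $$ (i, l)) * D $$ (l, k))"
    if "D \<in> carrier_mat n n" for s D
    using A C that i k by (simp add: scalar_prod_def)
  have prod': "(C * B t) $$ (i, k) = (\<Sum>l=0..<n. C $$ (i, l) * B t $$ (l, k))"
    using B[of t] C i k by (simp add: scalar_prod_def)
  have dim: "C * B t \<in> carrier_mat n n" "(A + t \<cdot>\<^sub>m C) * B' \<in> carrier_mat n n"
    using A B C B' by (auto intro!: mult_carrier_mat[of _ n n])
  have "((\<lambda>t. \<Sum>l=0..<n. (A $$ (i, l) + t * C $$ (i, l)) * B t $$ (l, k)) has_field_derivative
      (\<Sum>l=0..<n. C $$ (i, l) * B t $$ (l, k) + (A $$ (i, l) + t * C $$ (i, l)) * B' $$ (l, k))) (at t)"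
    by (rule DERIV_sum) (auto intro!: derivative_eq_intros der)
  moreover have "(C * B t + (A + t \<cdot>\<^sub>m C) * B') $$ (i, k) = 
     (\<Sum>l=0..<n. C $$ (i, l) * B t $$ (l, k) + (A $$ (i, l) + t * C $$ (i, l)) * B' $$ (l, k))"
    using dim i k C B' by (simp add: prod[OF B'] prod' sum.distrib del: index_mult_mat(1))
  ultimately show ?thesis
    by (simp only: prod[OF B])
qed

lemma has_field_derivative_word_eval:
  assumes X: "X \<in> sym_tuples n" and H: "H \<in> sym_tuples n" and "i < n" "k < n"
  shows "((\<lambda>t. word_eval n (tuple_line X H t) w $$ (i, k)) has_field_derivative
          word_deriv n (tuple_line X H t) H w $$ (i, k)) (at t)"
  using assms(3,4)
proof (induction w arbitrary: i)
  case (Cons j w)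
  have "((\<lambda>t. ((X j + t \<cdot>\<^sub>m H j) * word_eval n (tuple_line X H t) w) $$ (i, k)) has_field_derivative
     (H j * word_eval n (tuple_line X H t) w +
       (X j + t \<cdot>\<^sub>m H j) * word_deriv n (tuple_line X H t) H w) $$ (i, k)) (at t)"
    by (rule has_field_derivative_line_mult[where n = n])
      (use X H Cons in \<open>auto simp: sym_tuples_carrier tuple_line_sym_tuples\<close>)
  then show ?case by (simp add: tuple_line_def)
qed simp

lemma has_field_derivative_word_deriv:
  assumes X: "X \<in> sym_tuples n" and H: "H \<in> sym_tuples n" and "i < n" "k < n"
  shows "((\<lambda>t. word_deriv n (tuple_line X H t) H w $$ (i, k)) has_field_derivative
          word_deriv2 n (tuple_line X H t) H w $$ (i, k)) (at t)"
  using assms(3,4)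
proof (induction w arbitrary: i)
  case (Cons j w)
  let ?L = "tuple_line X H"
  let ?W = "\<lambda>t. word_eval n (?L t) w" and ?D = "\<lambda>t. word_deriv n (?L t) H w"
  let ?D2 = "\<lambda>t. word_deriv2 n (?L t) H w"
  have car: "X j \<in> carrier_mat n n" "H j \<in> carrier_mat n n" "?W s \<in> carrier_mat n n"
    "?D s \<in> carrier_mat n n" "?D2 s \<in> carrier_mat n n" for s
    using X H by (auto simp: sym_tuples_carrier tuple_line_sym_tuples)
  have 1: "((\<lambda>t. ((X j + t \<cdot>\<^sub>m H j) * ?D t) $$ (i, k)) has_field_derivative
     (H j * ?D t + (X j + t \<cdot>\<^sub>m H j) * ?D2 t) $$ (i, k)) (at t)"
    by (rule has_field_derivative_line_mult[where n = n]) (use car Cons in auto)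
  \<comment> \<open>The constant factor \<open>H j\<close> is the line through \<open>H j\<close> in direction \<open>0\<close>.\<close>
  have 2: "((\<lambda>t. ((H j + t \<cdot>\<^sub>m 0\<^sub>m n n) * ?W t) $$ (i, k)) has_field_derivative
     (0\<^sub>m n n * ?W t + (H j + t \<cdot>\<^sub>m 0\<^sub>m n n) * ?D t) $$ (i, k)) (at t)"
    by (rule has_field_derivative_line_mult[where n = n])
      (use car Cons in \<open>auto intro!: has_field_derivative_word_eval[OF X H]\<close>)
  have zero: "H j + s \<cdot>\<^sub>m 0\<^sub>m n n = H j" for s
    using car by auto
  have "0\<^sub>m n n * ?W t + H j * ?D t = H j * ?D t"
    using car(2) car(3)[of t] car(4)[of t] by (simp add: left_add_zero_mat[of _ n n])
  with 2 have 3: "((\<lambda>t. (H j * ?W t) $$ (i, k)) has_field_derivative (H j * ?D t) $$ (i, k)) (at t)"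
    by (simp only: zero)
  have dim: "H j * ?W s \<in> carrier_mat n n" "H j * ?D s \<in> carrier_mat n n"
    "(X j + s \<cdot>\<^sub>m H j) * ?D s \<in> carrier_mat n n" "(X j + s \<cdot>\<^sub>m H j) * ?D2 s \<in> carrier_mat n n" for s
    using car(1,2) car(3)[of s] car(4)[of s] car(5)[of s] by (auto intro!: mult_carrier_mat[of _ n n])
  have index_add: "(A + B) $$ (i, k) = A $$ (i, k) + B $$ (i, k)"
    if "A \<in> carrier_mat n n" "B \<in> carrier_mat n n" for A B :: "real mat"
    using that Cons.prems by simp
  have index_smult: "(c \<cdot>\<^sub>m A) $$ (i, k) = c * A $$ (i, k)"
    if "A \<in> carrier_mat n n" for A :: "real mat" and c
    using that Cons.prems by simp
  have sum1: "(H j * ?W s + (X j + s \<cdot>\<^sub>m H j) * ?D s) $$ (i, k) =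
     (H j * ?W s) $$ (i, k) + ((X j + s \<cdot>\<^sub>m H j) * ?D s) $$ (i, k)" for s
    by (rule index_add[OF dim(1)[of s] dim(3)[of s]])
  have sum2: "(2 \<cdot>\<^sub>m (H j * ?D t) + (X j + t \<cdot>\<^sub>m H j) * ?D2 t) $$ (i, k) =
     (H j * ?D t) $$ (i, k) + (H j * ?D t + (X j + t \<cdot>\<^sub>m H j) * ?D2 t) $$ (i, k)"
    
    using index_add[OF smult_carrier_mat[OF dim(2)[of t]] dim(4)[of t]]
      index_add[OF dim(2)[of t] dim(4)[of t]] index_smult[OF dim(2)[of t], of 2]
    by (simp del: index_mult_mat(1) index_add_mat(1) index_smult_mat(1))
  from DERIV_add[OF 3 1] show ?case
    unfolding word_deriv.simps word_deriv2.simps sum1[symmetric] sum2[symmetric]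
    by (simp only: tuple_line_def sum1[unfolded tuple_line_def] sum2[unfolded tuple_line_def])
qed simp

lemma tuple_line_0:
  assumes "X \<in> sym_tuples n" "H \<in> sym_tuples n" shows "tuple_line X H 0 = X"
proof
  fix j
  from sym_tuples_carrier[OF assms(1), of j] sym_tuples_carrier[OF assms(2), of j]
  show "tuple_line X H 0 j = X j" by (auto simp: tuple_line_def)
qed

lemma deriv_nc_eval_line:
  assumes X: "X \<in> sym_tuples n" and H: "H \<in> sym_tuples n" and i: "i < n" and k: "k < n"
  shows "deriv (\<lambda>t. nc_eval n p (tuple_line X H t) $$ (i, k)) =
    (\<lambda>t. wsum n p (word_deriv n (tuple_line X H t) H) $$ (i, k))"
proof
  fix t
  have "((\<lambda>t. \<Sum>w\<in>Poly_Mapping.keys p. Poly_Mapping.lookup p w * word_eval n (tuple_line X H t) w $$ (i, k))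
     has_field_derivative
      (\<Sum>w\<in>Poly_Mapping.keys p. Poly_Mapping.lookup p w * word_deriv n (tuple_line X H t) H w $$ (i, k))) (at t)"
    by (intro DERIV_sum DERIV_cmult has_field_derivative_word_eval[OF X H i k])
  then show "deriv (\<lambda>t. nc_eval n p (tuple_line X H t) $$ (i, k)) t =
      wsum n p (word_deriv n (tuple_line X H t) H) $$ (i, k)"
    using i k by (simp add: nc_eval_eq_wsum wsum_def DERIV_imp_deriv)
qed

lemma nc_deriv_eq_wsum:
  assumes X: "X \<in> sym_tuples n" and H: "H \<in> sym_tuples n"
  shows "nc_deriv n p X H = wsum n p (word_deriv n X H)"
  by (rule eq_matI)
    (auto simp: nc_deriv_def deriv_nc_eval_line[OF assms] tuple_line_0[OF assms] wsum_def)

lemma nc_deriv2_eq_wsum: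
  assumes X: "X \<in> sym_tuples n" and H: "H \<in> sym_tuples n"
  shows "nc_deriv2 n p X H = wsum n p (word_deriv2 n X H)"
proof (rule eq_matI)
  fix i k assume "i < dim_row (wsum n p (word_deriv2 n X H))" "k < dim_col (wsum n p (word_deriv2 n X H))"
  then have i: "i < n" and k: "k < n" by (simp_all add: wsum_def)
  have "((\<lambda>t. \<Sum>w\<in>Poly_Mapping.keys p. Poly_Mapping.lookup p w * word_deriv n (tuple_line X H t) H w $$ (i, k))
     has_field_derivative
      (\<Sum>w\<in>Poly_Mapping.keys p. Poly_Mapping.lookup p w * word_deriv2 n (tuple_line X H 0) H w $$ (i, k))) (at 0)"
    by (intro DERIV_sum DERIV_cmult has_field_derivative_word_deriv[OF X H i k])
  then have "deriv (\<lambda>t. wsum n p (word_deriv n (tuple_line X H t) H) $$ (i, k)) 0 =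
      wsum n p (word_deriv2 n X H) $$ (i, k)"
    using i k by (simp add: wsum_def DERIV_imp_deriv tuple_line_0[OF X H])
  then show "nc_deriv2 n p X H $$ (i, k) = wsum n p (word_deriv2 n X H) $$ (i, k)"
    using i k by (simp add: nc_deriv2_def numeral_2_eq_2 deriv_nc_eval_line[OF X H])
qed (simp_all add: nc_deriv2_def wsum_def)

section \<open>Expansion of the derivatives along the letters of a word\<close>

lemma word_mult_vec_carrier [simp]:
  assumes "X \<in> sym_tuples n" "v \<in> carrier_vec n"
  shows "word_eval n X w *\<^sub>v v \<in> carrier_vec n"
  using mult_mat_vec_carrier[OF word_eval_carrier assms(2)] assms(1) .

lemma sym_mult_vec_carrier [simp]:
  assumes "X \<in> sym_tuples n" "v \<in> carrier_vec n"
  shows "X j *\<^sub>v v \<in> carrier_vec n"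
  using mult_mat_vec_carrier[OF sym_tuples_carrier assms(2)] assms(1) .

lemma word_eval_Cons_mult_vec:
  assumes "X \<in> sym_tuples n" "v \<in> carrier_vec n"
  shows "word_eval n X (j # w) *\<^sub>v v = X j *\<^sub>v (word_eval n X w *\<^sub>v v)"
  using assms by (simp add: sym_tuples_carrier[OF assms(1)] assoc_mult_mat_vec[of _ n n _ n])

lemma word_deriv_Cons_mult_vec:
  assumes X: "X \<in> sym_tuples n" and H: "H \<in> sym_tuples n" and v: "v \<in> carrier_vec n"
  shows "word_deriv n X H (j # w) *\<^sub>v v =
    H j *\<^sub>v (word_eval n X w *\<^sub>v v) + X j *\<^sub>v (word_deriv n X H w *\<^sub>v v)"
proof -
  note car = sym_tuples_carrier[OF X, of j] sym_tuples_carrier[OF H, of j]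
    word_eval_carrier[OF X, of w] word_deriv_carrier[OF X H, of w]
  show ?thesis
    using car v add_mult_distrib_mat_vec[OF mult_carrier_mat[OF car(2,3)] mult_carrier_mat[OF car(1,4)] v]
    by (simp add: assoc_mult_mat_vec[of _ n n _ n])
qed

lemma word_deriv2_Cons_mult_vec:
  assumes X: "X \<in> sym_tuples n" and H: "H \<in> sym_tuples n" and v: "v \<in> carrier_vec n"
  shows "word_deriv2 n X H (j # w) *\<^sub>v v =
    2 \<cdot>\<^sub>v (H j *\<^sub>v (word_deriv n X H w *\<^sub>v v)) + X j *\<^sub>v (word_deriv2 n X H w *\<^sub>v v)"
proof -
  note car = sym_tuples_carrier[OF X, of j] sym_tuples_carrier[OF H, of j]
    word_deriv_carrier[OF X H, of w] word_deriv2_carrier[OF X H, of w]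
  have "(2 \<cdot>\<^sub>m (H j * word_deriv n X H w)) *\<^sub>v v = 2 \<cdot>\<^sub>v ((H j * word_deriv n X H w) *\<^sub>v v)"
    using mult_carrier_mat[OF car(2,3)] v by (intro eq_vecI) (auto simp del: assoc_mult_mat_vec index_mult_mat(1))
  then show ?thesis
    using car v add_mult_distrib_mat_vec[OF smult_carrier_mat[OF mult_carrier_mat[OF car(2,3)]] mult_carrier_mat[OF car(1,4)] v]
    by (simp add: assoc_mult_mat_vec[of _ n n _ n])
qed

lemma index_mult_mat_vec_sum:
  assumes "A \<in> carrier_mat n n" "v \<in> carrier_vec n" "i < n"
  shows "(A *\<^sub>v v) $ i = (\<Sum>j=0..<n. A $$ (i, j) * v $ j)"
  using assms by (simp add: scalar_prod_def)

lemma mult_mat_vec_linear_combination: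
  fixes A :: "real mat"
  assumes A: "A \<in> carrier_mat n n" and u: "u \<in> carrier_vec n"
    and f: "\<And>k. k \<in> K \<Longrightarrow> f k \<in> carrier_vec n"
    and eq: "\<And>i. i < n \<Longrightarrow> u $ i = (\<Sum>k\<in>K. c k * f k $ i)" and i: "i < n"
  shows "(A *\<^sub>v u) $ i = (\<Sum>k\<in>K. c k * (A *\<^sub>v f k) $ i)"
proof -
  have "(A *\<^sub>v u) $ i = (\<Sum>j=0..<n. A $$ (i, j) * (\<Sum>k\<in>K. c k * f k $ j))"
    using eq by (simp add: index_mult_mat_vec_sum[OF A u i] del: index_mult_mat_vec)
  also have "\<dots> = (\<Sum>k\<in>K. c k * (\<Sum>j=0..<n. A $$ (i, j) * f k $ j))"
    by (simp only: sum_distrib_left, subst sum.swap) (simp add: mult.left_commute)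
  also have "\<dots> = (\<Sum>k\<in>K. c k * (A *\<^sub>v f k) $ i)"
    by (intro sum.cong refl) (simp only: index_mult_mat_vec_sum[OF A f i])
  finally show ?thesis .
qed

text \<open>The first derivative applied to \<open>v\<close> only sees \<open>H\<close> through the vectors \<open>H\<^sub>j c(X) v\<close>, where \<open>c\<close>
  is what follows the replaced letter \<open>x\<^sub>j\<close>. These vectors are the true coordinates of \<open>H\<close> below.\<close>

lemma word_deriv_expansion:
  assumes X: "X \<in> sym_tuples n" and H: "H \<in> sym_tuples n" and v: "v \<in> carrier_vec n" and i: "i < n"
  shows "(word_deriv n X H w *\<^sub>v v) $ i =
    (\<Sum>l<length w. (word_eval n X (take l w) *\<^sub>v
       (H (w ! l) *\<^sub>v (word_eval n X (drop (Suc l) w) *\<^sub>v v))) $ i)"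
  using i
proof (induction w arbitrary: i)
  case Nil
  then show ?case using v by simp
next
  case (Cons j w)
  let ?u = "\<lambda>l. H (w ! l) *\<^sub>v (word_eval n X (drop (Suc l) w) *\<^sub>v v)"
  have u: "?u l \<in> carrier_vec n" for l using X H v by simp
  have Dw: "word_deriv n X H w *\<^sub>v v \<in> carrier_vec n"
    using mult_mat_vec_carrier[OF word_deriv_carrier v] X H .
  have shift: "(X j *\<^sub>v (word_deriv n X H w *\<^sub>v v)) $ i =
      (\<Sum>l<length w. 1 * (X j *\<^sub>v (word_eval n X (take l w) *\<^sub>v ?u l)) $ i)"
    by (rule mult_mat_vec_linear_combination[OF sym_tuples_carrier[OF X] Dw])
      (use X u Cons in \<open>auto simp del: index_mult_mat_vec\<close>)
  have car: "H j *\<^sub>v (word_eval n X w *\<^sub>v v) \<in> carrier_vec n"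
    "X j *\<^sub>v (word_deriv n X H w *\<^sub>v v) \<in> carrier_vec n"
    using X H v Dw by simp_all
  have "(word_deriv n X H (j # w) *\<^sub>v v) $ i =
      (H j *\<^sub>v (word_eval n X w *\<^sub>v v)) $ i + (X j *\<^sub>v (word_deriv n X H w *\<^sub>v v)) $ i"
    using carrier_vecD[OF car(1)] carrier_vecD[OF car(2)] Cons.prems
    by (simp add: word_deriv_Cons_mult_vec[OF X H v] del: index_mult_mat_vec dim_mult_mat_vec word_deriv.simps)
  also have "\<dots> = (\<Sum>l<length (j # w). (word_eval n X (take l (j # w)) *\<^sub>v
       (H ((j # w) ! l) *\<^sub>v (word_eval n X (drop (Suc l) (j # w)) *\<^sub>v v))) $ i)"
    using car u unfolding shift length_Cons sum.lessThan_Suc_shift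
    by (simp add: word_eval_Cons_mult_vec[OF X] del: index_mult_mat_vec word_eval_Cons)
  finally show ?case .
qed

text \<open>Pairing with \<open>a(X) v\<close> and moving the symmetric matrices in front of the first replaced letter
  to the other side of the scalar product reverses the prefix. The Hessian thereby becomes a form in
  the vectors \<open>H\<^sub>j c(X) v\<close>, too. The word \<open>a\<close> collects the letters moved so far.\<close>

lemma word_deriv2_expansion:
  assumes X: "X \<in> sym_tuples n" and H: "H \<in> sym_tuples n" and v: "v \<in> carrier_vec n"
  shows "scalar_prod (word_deriv2 n X H w *\<^sub>v v) (word_eval n X a *\<^sub>v v) =
    (\<Sum>k<length w. 2 * scalar_prod (word_deriv n X H (drop (Suc k) w) *\<^sub>v v)
       (H (w ! k) *\<^sub>v (word_eval n X (rev (take k w) @ a) *\<^sub>v v)))"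
proof (induction w arbitrary: a)
  case Nil
  have "0\<^sub>m n n *\<^sub>v v = 0\<^sub>v n" using v by (intro eq_vecI) auto
  then show ?case using X v by simp
next
  case (Cons j w)
  let ?a = "word_eval n X a *\<^sub>v v"
  have car: "?a \<in> carrier_vec n" "word_deriv n X H w *\<^sub>v v \<in> carrier_vec n"
    "word_deriv2 n X H w *\<^sub>v v \<in> carrier_vec n"
    using X v mult_mat_vec_carrier[OF word_deriv_carrier[OF X H] v]
      mult_mat_vec_carrier[OF word_deriv2_carrier[OF X H] v] by simp_all
  have "scalar_prod (word_deriv2 n X H (j # w) *\<^sub>v v) ?a =
      2 * scalar_prod (H j *\<^sub>v (word_deriv n X H w *\<^sub>v v)) ?a
      + scalar_prod (X j *\<^sub>v (word_deriv2 n X H w *\<^sub>v v)) ?a"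
    using car X H smult_scalar_prod_distrib[OF sym_mult_vec_carrier[OF H car(2)] car(1), of 2 j]
    by (simp add: word_deriv2_Cons_mult_vec[OF X H v] add_scalar_prod_distrib[of _ n] del: word_deriv2.simps)
  also have "\<dots> = 2 * scalar_prod (word_deriv n X H w *\<^sub>v v) (H j *\<^sub>v ?a)
      + scalar_prod (word_deriv2 n X H w *\<^sub>v v) (word_eval n X (j # a) *\<^sub>v v)"
    using car by (simp add: sym_adjoint[OF X] sym_adjoint[OF H] word_eval_Cons_mult_vec[OF X v] del: word_eval_Cons)
  also have "\<dots> = (\<Sum>k<length (j # w). 2 * scalar_prod (word_deriv n X H (drop (Suc k) (j # w)) *\<^sub>v v)
       (H ((j # w) ! k) *\<^sub>v (word_eval n X (rev (take k (j # w)) @ a) *\<^sub>v v)))"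
    unfolding Cons.IH length_Cons sum.lessThan_Suc_shift by simp
  finally show ?case .
qed

section \<open>Direct sums\<close>

abbreviation mat_dsum :: "real mat \<Rightarrow> real mat \<Rightarrow> real mat" where
  "mat_dsum A B \<equiv> four_block_mat A (0\<^sub>m (dim_row A) (dim_col B)) (0\<^sub>m (dim_row B) (dim_col A)) B"

definition tuple_dsum :: "('g \<Rightarrow> real mat) \<Rightarrow> ('g \<Rightarrow> real mat) \<Rightarrow> 'g \<Rightarrow> real mat" where
  "tuple_dsum X Y = (\<lambda>j. mat_dsum (X j) (Y j))"

lemma mat_dsum_mult:
  assumes "A \<in> carrier_mat n n" "B \<in> carrier_mat m m" "C \<in> carrier_mat n n" "D \<in> carrier_mat m m"
  shows "mat_dsum A B * mat_dsum C D = mat_dsum (A * C) (B * D)"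
  using assms by (simp add: mult_four_block_mat[of _ n n _ m _ m _ _ n _ m])

lemma mat_dsum_add:
  assumes "A \<in> carrier_mat n n" "B \<in> carrier_mat m m" "C \<in> carrier_mat n n" "D \<in> carrier_mat m m"
  shows "mat_dsum A B + mat_dsum C D = mat_dsum (A + C) (B + D)"
  using assms by (simp add: add_four_block_mat[of _ n n _ m _ m])

lemma mat_dsum_mult_vec:
  assumes "A \<in> carrier_mat n n" "B \<in> carrier_mat m m" "u \<in> carrier_vec n" "v \<in> carrier_vec m"
  shows "mat_dsum A B *\<^sub>v (u @\<^sub>v v) = (A *\<^sub>v u) @\<^sub>v (B *\<^sub>v v)"
  using mult_mat_vec_split[OF assms] assms by simp

lemma mat_dsum_transpose:
  assumes "A \<in> carrier_mat n n" "B \<in> carrier_mat m m"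
  shows "transpose_mat (mat_dsum A B) = mat_dsum (transpose_mat A) (transpose_mat B)"
  using assms by (intro eq_matI) auto

lemma tuple_dsum_sym_tuples [simp]:
  assumes "X \<in> sym_tuples n" "Y \<in> sym_tuples m"
  shows "tuple_dsum X Y \<in> sym_tuples (n + m)"
  using assms unfolding sym_tuples_def tuple_dsum_def
  by (auto simp: mat_dsum_transpose[of _ n _ m])

lemma word_eval_dsum:
  assumes X: "X \<in> sym_tuples n" and Y: "Y \<in> sym_tuples m"
  shows "word_eval (n + m) (tuple_dsum X Y) w = mat_dsum (word_eval n X w) (word_eval m Y w)"
proof (induction w)
  case (Cons j w)
  then show ?case
    using mat_dsum_mult[OF sym_tuples_carrier[OF X, of j] sym_tuples_carrier[OF Y, of j] 
        word_eval_carrier[OF X, of w] word_eval_carrier[OF Y, of w]]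
    by (simp add: tuple_dsum_def)
qed simp

lemma word_deriv_dsum:
  assumes X: "X \<in> sym_tuples n" and Y: "Y \<in> sym_tuples m"
    and H: "H \<in> sym_tuples n" and K: "K \<in> sym_tuples m"
  shows "word_deriv (n + m) (tuple_dsum X Y) (tuple_dsum H K) w =
    mat_dsum (word_deriv n X H w) (word_deriv m Y K w)"
proof (induction w)
  case (Cons j w)
  note x = sym_tuples_carrier[OF X, of j] and y = sym_tuples_carrier[OF Y, of j]
    and h = sym_tuples_carrier[OF H, of j] and k = sym_tuples_carrier[OF K, of j]
    and ex = word_eval_carrier[OF X, of w] and ey = word_eval_carrier[OF Y, of w]
    and dx = word_deriv_carrier[OF X H, of w] and dy = word_deriv_carrier[OF Y K, of w]
  have "word_deriv (n + m) (tuple_dsum X Y) (tuple_dsum H K) (j # w) =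
      mat_dsum (H j) (K j) * mat_dsum (word_eval n X w) (word_eval m Y w)
      + mat_dsum (X j) (Y j) * mat_dsum (word_deriv n X H w) (word_deriv m Y K w)"
    by (simp only: word_deriv.simps Cons.IH word_eval_dsum[OF X Y]) (simp only: tuple_dsum_def)
  also have "\<dots> = mat_dsum (H j * word_eval n X w) (K j * word_eval m Y w)
      + mat_dsum (X j * word_deriv n X H w) (Y j * word_deriv m Y K w)"
    by (simp only: mat_dsum_mult[OF h k ex ey] mat_dsum_mult[OF x y dx dy])
  also have "\<dots> = mat_dsum (word_deriv n X H (j # w)) (word_deriv m Y K (j # w))"
    using mat_dsum_add[OF mult_carrier_mat[OF h ex] mult_carrier_mat[OF k ey]
        mult_carrier_mat[OF x dx] mult_carrier_mat[OF y dy]]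
    by simp
  finally show ?case .
qed simp

lemma wsum_dsum:
  assumes F: "\<And>w. F w \<in> carrier_mat n n" and G: "\<And>w. G w \<in> carrier_mat m m"
  shows "wsum (n + m) p (\<lambda>w. mat_dsum (F w) (G w)) = mat_dsum (wsum n p F) (wsum m p G)"
proof -
  have dims: "dim_row (F w) = n" "dim_col (F w) = n" "dim_row (G w) = m" "dim_col (G w) = m" for w
    using F[of w] G[of w] by auto
  show ?thesis
    by (rule eq_matI) (auto simp: wsum_def dims)
qed

lemma nc_eval_dsum:
  assumes X: "X \<in> sym_tuples n" and Y: "Y \<in> sym_tuples m"
  shows "nc_eval (n + m) q (tuple_dsum X Y) = mat_dsum (nc_eval n q X) (nc_eval m q Y)"
proof -
  have "word_eval (n + m) (tuple_dsum X Y) = (\<lambda>w. mat_dsum (word_eval n X w) (word_eval m Y w))"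
    by (intro ext word_eval_dsum[OF assms])
  then show ?thesis
    using assms by (simp add: nc_eval_eq_wsum wsum_dsum)
qed

lemma nc_deriv_dsum:
  assumes X: "X \<in> sym_tuples n" and Y: "Y \<in> sym_tuples m"
    and H: "H \<in> sym_tuples n" and K: "K \<in> sym_tuples m"
  shows "nc_deriv (n + m) q (tuple_dsum X Y) (tuple_dsum H K) =
    mat_dsum (nc_deriv n q X H) (nc_deriv m q Y K)"
proof -
  have "word_deriv (n + m) (tuple_dsum X Y) (tuple_dsum H K) =
      (\<lambda>w. mat_dsum (word_deriv n X H w) (word_deriv m Y K w))"
    by (intro ext word_deriv_dsum[OF assms])
  then show ?thesis
    using assms by (simp add: nc_deriv_eq_wsum wsum_dsum)
qed

lemma nc_eval_carrier [simp]: "nc_eval n q X \<in> carrier_mat n n"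
  by (simp add: nc_eval_def)

lemma nc_deriv_carrier [simp]: "nc_deriv n q X H \<in> carrier_mat n n"
  by (simp add: nc_deriv_def)

lemma pos_def_dsum:
  assumes A: "pos_def n A" and B: "pos_def m B"
  shows "pos_def (n + m) (mat_dsum A B)"
proof -
  have car: "A \<in> carrier_mat n n" "B \<in> carrier_mat m m"
    and tr: "transpose_mat A = A" "transpose_mat B = B"
    using A B by (auto simp: pos_def_def)
  have "scalar_prod (mat_dsum A B *\<^sub>v x) x > 0"
    if x: "x \<in> carrier_vec (n + m)" "x \<noteq> 0\<^sub>v (n + m)" for x
  proof -
    define u where "u = vec_first x n"
    define v where "v = vec_last x m"
    have uv: "u \<in> carrier_vec n" "v \<in> carrier_vec m" "x = u @\<^sub>v v"
      using x by (auto simp: u_def v_def)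
    have Ann: "scalar_prod (A *\<^sub>v u) u \<ge> 0" "u \<noteq> 0\<^sub>v n \<Longrightarrow> scalar_prod (A *\<^sub>v u) u > 0"
      using A uv by (cases "u = 0\<^sub>v n"; force simp: pos_def_def)+
    have Bnn: "scalar_prod (B *\<^sub>v v) v \<ge> 0" "v \<noteq> 0\<^sub>v m \<Longrightarrow> scalar_prod (B *\<^sub>v v) v > 0"
      using B uv by (cases "v = 0\<^sub>v m"; force simp: pos_def_def)+
    have "u \<noteq> 0\<^sub>v n \<or> v \<noteq> 0\<^sub>v m"
      using x(2) uv(3) by auto
    then have "scalar_prod (A *\<^sub>v u) u + scalar_prod (B *\<^sub>v v) v > 0"
      using Ann Bnn by linarith
    moreover have "scalar_prod (mat_dsum A B *\<^sub>v x) x = scalar_prod (A *\<^sub>v u) u + scalar_prod (B *\<^sub>v v) v"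
      using mat_dsum_mult_vec[OF car uv(1,2)] scalar_prod_append[of _ n _ m u v] uv car by simp
    ultimately show ?thesis by simp
  qed
  then show ?thesis
    using mat_dsum_transpose[OF car] car tr by (auto simp: pos_def_def)
qed

lemma full_rank_points_inD:
  assumes "(X, v) \<in> full_rank_points_in p \<O>"
  shows "dim_vec v \<ge> 1" "X \<in> sym_tuples (dim_vec v)"
    and "nc_eval (dim_vec v) p X *\<^sub>v v = 0\<^sub>v (dim_vec v)"
proof -
  obtain n where "n \<ge> 1" "(X, v) \<in> nc_variety_at p n"
    using assms by (auto simp: full_rank_points_in_def full_rank_point_def nc_variety_def)
  moreover from this have "dim_vec v = n" by (auto simp: nc_variety_at_def)
  ultimately show "dim_vec v \<ge> 1" "X \<in> sym_tuples (dim_vec v)"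
    "nc_eval (dim_vec v) p X *\<^sub>v v = 0\<^sub>v (dim_vec v)"
    by (auto simp: nc_variety_at_def)
qed

text \<open>Block diagonal directions already make the derivative onto at a direct sum, and a direct sum of
  positive definite matrices is positive definite; hence full rank points in \<open>\<O>\<close> can be added.\<close>

lemma full_rank_points_in_dsum:
  assumes O: "nc_basic_open_semialgebraic \<O>"
    and P: "(X, v) \<in> full_rank_points_in p \<O>" and Q: "(Y, u) \<in> full_rank_points_in p \<O>"
  shows "(tuple_dsum X Y, v @\<^sub>v u) \<in> full_rank_points_in p \<O>"
proof -
  define n where "n = dim_vec v"
  define m where "m = dim_vec u"
  have v: "v \<in> carrier_vec n" and u: "u \<in> carrier_vec m"
    by (simp_all add: n_def m_def)
  have dim: "k = k'" if "X \<in> sym_tuples k" "X \<in> sym_tuples k'" for X :: "'a \<Rightarrow> real mat" and k k'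
    using sym_tuples_carrier[OF that(1), of undefined] sym_tuples_carrier[OF that(2), of undefined] by auto
  have V: "n \<ge> 1" "X \<in> sym_tuples n" "nc_eval n p X *\<^sub>v v = 0\<^sub>v n"
    and V': "m \<ge> 1" "Y \<in> sym_tuples m" "nc_eval m p Y *\<^sub>v u = 0\<^sub>v m"
    using full_rank_points_inD[OF P] full_rank_points_inD[OF Q] by (simp_all add: n_def m_def)
  have onto: "carrier_vec n \<subseteq> (\<lambda>H. nc_deriv n p X H *\<^sub>v v) ` sym_tuples n"
    "carrier_vec m \<subseteq> (\<lambda>H. nc_deriv m p Y H *\<^sub>v u) ` sym_tuples m"
    using P Q by (auto simp: full_rank_points_in_def full_rank_point_def n_def m_def)
  obtain ps where ps: "\<And>k. k \<ge> 1 \<Longrightarrow> \<O> k = {X \<in> sym_tuples k. \<forall>q\<in>set ps. pos_def k (nc_eval k q X)}"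
    using O by (auto simp: nc_basic_open_semialgebraic_def)
  have pd: "pos_def n (nc_eval n q X)" "pos_def m (nc_eval m q Y)" if "q \<in> set ps" for q
    using P Q ps that dim[OF V(2)] dim[OF V'(2)] by (auto simp: full_rank_points_in_def)
  have inO: "tuple_dsum X Y \<in> \<O> (n + m)"
    using V V' pd by (auto simp: ps nc_eval_dsum intro!: pos_def_dsum)
  have "nc_eval (n + m) p (tuple_dsum X Y) *\<^sub>v (v @\<^sub>v u) = 0\<^sub>v n @\<^sub>v 0\<^sub>v m"
    using V V' by (simp add: nc_eval_dsum mat_dsum_mult_vec[of _ n _ m] v u)
  then have var: "(tuple_dsum X Y, v @\<^sub>v u) \<in> nc_variety_at p (n + m)"
    using V V' v u by (auto simp: nc_variety_at_def)
  have "(\<lambda>H. nc_deriv (n + m) p (tuple_dsum X Y) H *\<^sub>v (v @\<^sub>v u)) ` sym_tuples (n + m) = carrier_vec (n + m)"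
  proof (intro equalityI subsetI)
    fix x :: "real Matrix.vec" assume x: "x \<in> carrier_vec (n + m)"
    obtain H where H: "H \<in> sym_tuples n" "vec_first x n = nc_deriv n p X H *\<^sub>v v"
      using subsetD[OF onto(1) vec_first_carrier[of x n]] by auto
    obtain K where K: "K \<in> sym_tuples m" "vec_last x m = nc_deriv m p Y K *\<^sub>v u"
      using subsetD[OF onto(2) vec_last_carrier[of x m]] by auto
    have "x = nc_deriv (n + m) p (tuple_dsum X Y) (tuple_dsum H K) *\<^sub>v (v @\<^sub>v u)"
      using vec_first_last_append[OF x] H K V V' v u
      by (simp add: nc_deriv_dsum mat_dsum_mult_vec[of _ n _ m])
    then show "x \<in> (\<lambda>H. nc_deriv (n + m) p (tuple_dsum X Y) H *\<^sub>v (v @\<^sub>v u)) ` sym_tuples (n + m)"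
      using H K by (intro image_eqI[where x = "tuple_dsum H K"]) auto
  next
    fix x assume "x \<in> (\<lambda>H. nc_deriv (n + m) p (tuple_dsum X Y) H *\<^sub>v (v @\<^sub>v u)) ` sym_tuples (n + m)"
    then show "x \<in> carrier_vec (n + m)"
      using mult_mat_vec_carrier[OF nc_deriv_carrier append_carrier_vec[OF v u]] by auto
  qed
  moreover have "(tuple_dsum X Y, v @\<^sub>v u) \<in> nc_variety p"
    using var V(1) by (auto simp: nc_variety_def intro!: bexI[of _ "n + m"])
  moreover have "\<exists>k\<ge>1. tuple_dsum X Y \<in> \<O> k"
    using inO V(1) by (intro exI[of _ "n + m"]) auto
  ultimately show ?thesis
    by (simp add: full_rank_points_in_def full_rank_point_def n_def m_def)
qed

section \<open>Independent families of vectors and symmetric interpolation\<close>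

definition vec_independent :: "nat \<Rightarrow> ('i \<Rightarrow> real Matrix.vec) \<Rightarrow> 'i set \<Rightarrow> bool" where
  "vec_independent n u S \<longleftrightarrow>
     (\<forall>c. (\<forall>i<n. (\<Sum>s\<in>S. c s * u s $ i) = 0) \<longrightarrow> (\<forall>s\<in>S. c s = 0))"

lemma scalar_prod_linear_combination:
  fixes u x :: "real Matrix.vec"
  assumes u: "u \<in> carrier_vec n" and f: "\<And>k. k \<in> K \<Longrightarrow> f k \<in> carrier_vec n" and x: "x \<in> carrier_vec n"
    and eq: "\<And>i. i < n \<Longrightarrow> u $ i = (\<Sum>k\<in>K. c k * f k $ i)"
  shows "scalar_prod u x = (\<Sum>k\<in>K. c k * scalar_prod (f k) x)"
proof -
  have "scalar_prod u x = (\<Sum>i=0..<n. (\<Sum>k\<in>K. c k * f k $ i) * x $ i)"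
    using x eq by (simp add: scalar_prod_def)
  also have "\<dots> = (\<Sum>k\<in>K. c k * (\<Sum>i=0..<n. f k $ i * x $ i))"
    by (simp only: sum_distrib_left sum_distrib_right, subst sum.swap) (simp add: mult.assoc)
  also have "\<dots> = (\<Sum>k\<in>K. c k * scalar_prod (f k) x)"
    using x by (simp add: scalar_prod_def)
  finally show ?thesis .
qed

text \<open>Gram-Schmidt without square roots: a vector outside a span is detected by a vector orthogonal to
  the span.\<close>

lemma span_separation:
  fixes u :: "'i \<Rightarrow> real Matrix.vec"
  assumes "finite S" and "\<And>s. s \<in> S \<Longrightarrow> u s \<in> carrier_vec n" and "x \<in> carrier_vec n"
    and "\<And>c. \<exists>i<n. x $ i \<noteq> (\<Sum>s\<in>S. c s * u s $ i)"
  shows "\<exists>e\<in>carrier_vec n. scalar_prod e x = 1 \<and> (\<forall>s\<in>S. scalar_prod e (u s) = 0)"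
  using assms
proof (induction S arbitrary: x rule: finite_induct)
  case empty
  obtain i where i: "i < n" "x $ i \<noteq> 0" using empty.prems(3) by auto
  then have "scalar_prod ((1 / x $ i) \<cdot>\<^sub>v unit_vec n i) x = 1"
    using empty.prems(2) by simp
  then show ?case
    by (intro bexI[of _ "(1 / x $ i) \<cdot>\<^sub>v unit_vec n i"]) auto
next
  case (insert t S)
  have ut: "u t \<in> carrier_vec n" and uS: "\<And>s. s \<in> S \<Longrightarrow> u s \<in> carrier_vec n"
    using insert.prems by auto
  have not_span: "\<exists>i<n. (x - a \<cdot>\<^sub>v u t) $ i \<noteq> (\<Sum>s\<in>S. c s * u s $ i)" for a c
  proof -
    obtain i where i: "i < n" "x $ i \<noteq> (\<Sum>s\<in>insert t S. (c(t := a)) s * u s $ i)"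
      using insert.prems(3) by blast
    have "(\<Sum>s\<in>S. (c(t := a)) s * u s $ i) = (\<Sum>s\<in>S. c s * u s $ i)"
      using insert.hyps(2) by (intro sum.cong) auto
    then show ?thesis
      using i insert.hyps insert.prems(2) ut by (intro exI[of _ i]) (auto simp: algebra_simps)
  qed
  show ?case
  proof (cases "\<forall>c. \<exists>i<n. u t $ i \<noteq> (\<Sum>s\<in>S. c s * u s $ i)")
    case True
    then obtain f where f: "f \<in> carrier_vec n" "scalar_prod f (u t) = 1" "\<forall>s\<in>S. scalar_prod f (u s) = 0"
      using insert.IH[OF uS ut] by blast
    \<comment> \<open>Subtracting the right multiple of \<open>u t\<close> from \<open>x\<close> makes the correction by \<open>f\<close> below
      keep the value 1.\<close>
    define x' where "x' = x - scalar_prod f x \<cdot>\<^sub>v u t"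
    have x': "x' \<in> carrier_vec n" using insert.prems(2) ut by (simp add: x'_def)
    then obtain e where e: "e \<in> carrier_vec n" "scalar_prod e x' = 1" "\<forall>s\<in>S. scalar_prod e (u s) = 0"
      using insert.IH[OF uS x'] not_span unfolding x'_def by blast
    have ex: "scalar_prod e x - scalar_prod f x * scalar_prod e (u t) = 1"
      using e insert.prems(2) ut by (simp add: x'_def scalar_prod_minus_distrib[of _ n])
    define e' where "e' = e - scalar_prod e (u t) \<cdot>\<^sub>v f"
    have e': "scalar_prod e' y = scalar_prod e y - scalar_prod e (u t) * scalar_prod f y"
      if "y \<in> carrier_vec n" for y
      using that e f by (simp add: e'_def minus_scalar_prod_distrib[of _ n])
    show ?thesis
    proof (intro bexI[of _ e'] conjI ballI)
      show "scalar_prod e' x = 1" using ex e'[OF insert.prems(2)] by (simp add: mult.commute)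
      show "e' \<in> carrier_vec n" using e f by (simp add: e'_def)
      fix s assume "s \<in> insert t S"
      then show "scalar_prod e' (u s) = 0" using e f ut uS by (auto simp: e')
    qed
  next
    case False
    then obtain b where b: "\<And>i. i < n \<Longrightarrow> u t $ i = (\<Sum>s\<in>S. b s * u s $ i)" by blast
    have "\<exists>i<n. x $ i \<noteq> (\<Sum>s\<in>S. c s * u s $ i)" for c
      using not_span[of 0 c] insert.prems(2) ut by auto
    then obtain e where e: "e \<in> carrier_vec n" "scalar_prod e x = 1" "\<forall>s\<in>S. scalar_prod e (u s) = 0"
      using insert.IH[OF uS insert.prems(2)] by blast
    have "scalar_prod (u t) e = (\<Sum>s\<in>S. b s * scalar_prod (u s) e)"
      by (rule scalar_prod_linear_combination[OF ut _ e(1)]) (use uS b in auto)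
    also have "\<dots> = 0"
      using e uS by (intro sum.neutral) (auto simp: comm_scalar_prod[of _ n e])
    finally show ?thesis
      using e ut by (intro bexI[of _ e]) (auto simp: comm_scalar_prod[of _ n e])
  qed
qed

lemma dual_family:
  assumes fin: "finite S" and u: "\<And>s. s \<in> S \<Longrightarrow> u s \<in> carrier_vec n" and ind: "vec_independent n u S"
  shows "\<exists>e. \<forall>s\<in>S. e s \<in> carrier_vec n \<and> (\<forall>t\<in>S. scalar_prod (e s) (u t) = (if s = t then 1 else 0))"
proof (rule bchoice, rule ballI)
  fix s assume s: "s \<in> S"
  have "\<exists>i<n. u s $ i \<noteq> (\<Sum>t\<in>S - {s}. c t * u t $ i)" for c
  proof (rule ccontr)
    assume "\<not> ?thesis"
    then have eq: "u s $ i = (\<Sum>t\<in>S - {s}. c t * u t $ i)" if "i < n" for i using that by auto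
    have "(\<Sum>t\<in>S. (c(s := -1)) t * u t $ i) = 0" if "i < n" for i
    proof -
      have "(\<Sum>t\<in>S - {s}. (c(s := -1)) t * u t $ i) = (\<Sum>t\<in>S - {s}. c t * u t $ i)"
        by (intro sum.cong) auto
      then show ?thesis using eq[OF that] by (simp add: sum.remove[OF fin s])
    qed
    then have "(c(s := -1)) s = 0" using ind s unfolding vec_independent_def by blast
    then show False by simp
  qed
  then obtain e where e: "e \<in> carrier_vec n" "scalar_prod e (u s) = 1" "\<forall>t\<in>S - {s}. scalar_prod e (u t) = 0"
    using span_separation[of "S - {s}" u n "u s"] fin u s by blast
  then show "\<exists>e. e \<in> carrier_vec n \<and> (\<forall>t\<in>S. scalar_prod e (u t) = (if s = t then 1 else 0))"
    by (intro exI[of _ e]) auto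
qed

text \<open>Symmetry restricts the images of independent vectors \<open>u\<^sub>s\<close> only through their scalar products
  with the \<open>u\<^sub>t\<close>. If the prescribed images \<open>h\<^sub>s\<close> are orthogonal to all of these, nothing is left of
  the restriction, and \<open>\<Sum>\<^sub>s (h\<^sub>s e\<^sub>s\<^sup>T + e\<^sub>s h\<^sub>s\<^sup>T)\<close> with a dual family \<open>e\<close> interpolates.\<close>

lemma symmetric_interpolation:
  fixes u h :: "'i \<Rightarrow> real Matrix.vec"
  assumes fin: "finite S" and u: "\<And>s. s \<in> S \<Longrightarrow> u s \<in> carrier_vec n" and ind: "vec_independent n u S"
    and h: "\<And>s. s \<in> S \<Longrightarrow> h s \<in> carrier_vec n"
    and orth: "\<And>s t. s \<in> S \<Longrightarrow> t \<in> S \<Longrightarrow> scalar_prod (h s) (u t) = 0"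
  shows "\<exists>A. A \<in> carrier_mat n n \<and> transpose_mat A = A \<and> (\<forall>s\<in>S. A *\<^sub>v u s = h s)"
proof -
  obtain e where e: "\<And>s. s \<in> S \<Longrightarrow> e s \<in> carrier_vec n"
    "\<And>s t. s \<in> S \<Longrightarrow> t \<in> S \<Longrightarrow> scalar_prod (e s) (u t) = (if s = t then 1 else 0)"
    using dual_family[OF fin u ind] by metis
  define A where "A = mat n n (\<lambda>(a, b). \<Sum>s\<in>S. h s $ a * e s $ b + e s $ a * h s $ b)"
  have A: "A \<in> carrier_mat n n" by (simp add: A_def)
  have "A *\<^sub>v u t = h t" if t: "t \<in> S" for t
  proof (rule eq_vecI)
    fix a assume "a < dim_vec (h t)"
    then have a: "a < n" using h[OF t] by simp
    have "(A *\<^sub>v u t) $ a = (\<Sum>b=0..<n. (\<Sum>s\<in>S. h s $ a * e s $ b + e s $ a * h s $ b) * u t $ b)"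
      unfolding index_mult_mat_vec_sum[OF A u[OF t] a] using a by (simp add: A_def)
    also have "\<dots> = (\<Sum>s\<in>S. \<Sum>b=0..<n. h s $ a * (e s $ b * u t $ b) + e s $ a * (h s $ b * u t $ b))"
      by (simp only: sum_distrib_right, subst sum.swap) (simp add: algebra_simps)
    also have "\<dots> = (\<Sum>s\<in>S. h s $ a * scalar_prod (e s) (u t) + e s $ a * scalar_prod (h s) (u t))"
      using u[OF t] by (simp add: scalar_prod_def sum.distrib sum_distrib_left)
    also have "\<dots> = (\<Sum>s\<in>S. if s = t then h t $ a else 0)"
      using t by (intro sum.cong) (auto simp: e orth)
    also have "\<dots> = h t $ a" using fin t by simp
    finally show "(A *\<^sub>v u t) $ a = h t $ a" .
  qed (use h[OF t] A in simp)
  moreover have "transpose_mat A = A"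
    by (rule eq_matI) (auto simp: A_def algebra_simps)
  ultimately show ?thesis using A by blast
qed

section \<open>The curvature condition as a form in word coefficients\<close>

text \<open>The sum over all factorisations \<open>w = a x\<^sub>i b x\<^sub>j c\<close> of \<open>\<gamma>(i, a\<^sup>T) \<delta>(j, c) G(b)\<close>. With
  \<open>H\<^sub>i c(X) v = \<gamma>(i, c) y\<close> and \<open>G(b) = \<langle>b(X) y, y\<rangle>\<close> it is half of the contribution of \<open>w\<close> to
  \<open>\<langle>p''(X)[H] v, v\<rangle>\<close>.
  Separate arguments \<open>\<gamma>\<close>, \<open>\<delta>\<close> make it bilinear.\<close>

definition split_form ::
  "('g list \<Rightarrow> real) \<Rightarrow> ('g \<Rightarrow> 'g list \<Rightarrow> real) \<Rightarrow> ('g \<Rightarrow> 'g list \<Rightarrow> real) \<Rightarrow> 'g list \<Rightarrow> real" where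
  "split_form G \<gamma> \<delta> w = (\<Sum>k<length w. \<Sum>m<length w - Suc k.
     \<gamma> (w ! k) (rev (take k w)) * \<delta> (w ! (Suc k + m)) (drop (Suc (Suc k + m)) w)
       * G (take m (drop (Suc k) w)))"

lemma finite_words_less: "finite {c :: 'g::finite list. length c < d}"
proof -
  have "{c :: 'g list. length c < d} \<subseteq> {c. set c \<subseteq> UNIV \<and> length c \<le> d}" by auto
  then show ?thesis by (rule finite_subset) (rule finite_lists_length_le[OF finite])
qed

text \<open>Let \<open>d\<close> be the degree of \<open>p\<close> and \<open>y\<close> be orthogonal to all \<open>w(X) v\<close>. Tangency involves
  \<open>H\<^sub>i c(X) v\<close> for all \<open>c\<close> of length at most \<open>d - 1\<close>, the Hessian only those of length at most
  \<open>d - 2\<close>. So the latter can be prescribed freely as \<open>\<gamma>(i, c) y\<close>, while a single vector of the top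
  layer, the image belonging to a word \<open>w0\<close> of length \<open>d\<close>, is spent on solving the tangency
  equation. Everything stays orthogonal to the \<open>w(X) v\<close>, so that a symmetric \<open>H\<close> with these values
  exists.\<close>

lemma curvature_split_form_nonpos:
  fixes p :: "'g::finite ncpoly" and y :: "real Matrix.vec"
  assumes X: "X \<in> sym_tuples n" and v: "v \<in> carrier_vec n" and y: "y \<in> carrier_vec n"
    and ind: "vec_independent n (\<lambda>w. word_eval n X w *\<^sub>v v) {c. length c < d}"
    and orth: "\<And>w. scalar_prod y (word_eval n X w *\<^sub>v v) = 0"
    and w0: "w0 \<in> Poly_Mapping.keys p" "length w0 = d" "d > 0"
    and deg: "\<And>w. w \<in> Poly_Mapping.keys p \<Longrightarrow> length w \<le> d"
    and curv: "\<And>H. H \<in> sym_tuples n \<Longrightarrow> nc_deriv n p X H *\<^sub>v v = 0\<^sub>v n \<Longrightarrow>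
      scalar_prod (nc_deriv2 n p X H *\<^sub>v v) v \<le> 0"
    and supp: "\<And>i c. d \<le> Suc (length c) \<Longrightarrow> \<gamma> i c = 0"
  shows "(\<Sum>w\<in>Poly_Mapping.keys p. Poly_Mapping.lookup p w *
    split_form (\<lambda>b. scalar_prod (word_eval n X b *\<^sub>v y) y) \<gamma> \<gamma> w) \<le> 0"
proof -
  let ?K = "Poly_Mapping.keys p" and ?p = "Poly_Mapping.lookup p"
  let ?u = "\<lambda>w. word_eval n X w *\<^sub>v v" and ?y = "\<lambda>w. word_eval n X w *\<^sub>v y"
  have u: "?u w \<in> carrier_vec n" and yw: "?y w \<in> carrier_vec n" for w
    using X v y by simp_all
  have p0: "?p w0 \<noteq> 0" using w0(1) by (simp add: in_keys_iff)
  have orth': "scalar_prod (?y b) (?u w) = 0" for b w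
    using orth[of "rev b @ w"] X v y
    by (simp add: word_eval_adjoint[OF X y u] word_eval_append[OF X] assoc_mult_mat_vec[of _ n n _ n])
  \<comment> \<open>The part of the first derivative of the word \<open>w\<close> that comes from \<open>\<gamma>\<close>.\<close>
  define S where "S w = vec n (\<lambda>i. \<Sum>l<length w. \<gamma> (w ! l) (drop (Suc l) w) * ?y (take l w) $ i)" for w
  have S: "S w \<in> carrier_vec n" for w by (simp add: S_def)
  have S_prod: "scalar_prod (S w) x =
      (\<Sum>l<length w. \<gamma> (w ! l) (drop (Suc l) w) * scalar_prod (?y (take l w)) x)"
    if "x \<in> carrier_vec n" for w x
    by (rule scalar_prod_linear_combination[OF S _ that]) (auto simp: yw S_def)
  \<comment> \<open>The tangency equation reads \<open>\<Sum>\<^sub>w p\<^sub>w S(w) + p\<^sub>w\<^sub>0 z = 0\<close>.\<close>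
  define z where "z = vec n (\<lambda>i. \<Sum>w\<in>?K. (- ?p w / ?p w0) * S w $ i)"
  have z: "z \<in> carrier_vec n" by (simp add: z_def)
  have z_orth: "scalar_prod z (?u w) = 0" for w
  proof -
    have "scalar_prod z (?u w) = (\<Sum>w'\<in>?K. (- ?p w' / ?p w0) * scalar_prod (S w') (?u w))"
      by (rule scalar_prod_linear_combination[OF z _ u]) (auto simp: S z_def)
    then show ?thesis by (simp add: S_prod[OF u] orth')
  qed
  define h where "h i c = (if Suc (length c) < d then \<gamma> i c \<cdot>\<^sub>v y else if i # c = w0 then z else 0\<^sub>v n)" for i c
  have "\<exists>A. A \<in> carrier_mat n n \<and> transpose_mat A = A \<and> (\<forall>c\<in>{c. length c < d}. A *\<^sub>v ?u c = h i c)" for i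
    by (rule symmetric_interpolation[OF finite_words_less u ind])
      (use y z u orth z_orth in \<open>auto simp: h_def smult_scalar_prod_distrib[of _ n]\<close>)
  then obtain H where H: "\<And>i. H i \<in> carrier_mat n n" "\<And>i. transpose_mat (H i) = H i"
    "\<And>i c. length c < d \<Longrightarrow> H i *\<^sub>v ?u c = h i c"
    by (metis mem_Collect_eq)
  have Hs: "H \<in> sym_tuples n" using H by (simp add: sym_tuples_def)
  have D: "word_deriv n X H w *\<^sub>v v \<in> carrier_vec n" for w
    using mult_mat_vec_carrier[OF word_deriv_carrier v] X Hs .
  have deriv_w: "(word_deriv n X H w *\<^sub>v v) $ i = S w $ i + (if w = w0 then z $ i else 0)"
    if w: "length w \<le> d" and i: "i < n" for w i
  proof -
    have "(word_eval n X (take l w) *\<^sub>v (H (w ! l) *\<^sub>v ?u (drop (Suc l) w))) $ i =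
        \<gamma> (w ! l) (drop (Suc l) w) * ?y (take l w) $ i + (if l = 0 then if w = w0 then z $ i else 0 else 0)"
      if l: "l < length w" for l
    proof -
      let ?c = "drop (Suc l) w"
      have H_u: "H (w ! l) *\<^sub>v ?u ?c = h (w ! l) ?c" using l w by (intro H(3)) simp
      show ?thesis
      proof (cases "Suc (length ?c) < d")
        case True
        have no_z: "(if l = 0 then if w = w0 then z $ i else 0 else 0) = 0"
          using True l w0(2) by auto
        have image: "word_eval n X (take l w) *\<^sub>v h (w ! l) ?c = \<gamma> (w ! l) ?c \<cdot>\<^sub>v ?y (take l w)"
          using True mult_mat_vec[OF word_eval_carrier[OF X] y] by (simp add: h_def)
        have entry: "(\<gamma> (w ! l) ?c \<cdot>\<^sub>v ?y (take l w)) $ i = \<gamma> (w ! l) ?c * ?y (take l w) $ i"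
          using i carrier_vecD[OF yw] by (simp del: index_mult_mat_vec dim_mult_mat_vec)
        show ?thesis
          unfolding H_u image entry no_z by simp
      next
        case False
        then have l0: "l = 0" "length w = d" using l w by auto
        then have "w ! 0 # drop (Suc 0) w = w" using l by (cases w) auto
        then have h_eq: "h (w ! l) ?c = (if w = w0 then z else 0\<^sub>v n)"
          using l0 False by (simp add: h_def)
        have "\<gamma> (w ! l) ?c = 0" using False by (intro supp) simp
        then show ?thesis
          unfolding H_u h_eq using l0(1) i z by (simp del: index_mult_mat_vec)
      qed
    qed
    then have "(word_deriv n X H w *\<^sub>v v) $ i = (\<Sum>l<length w. \<gamma> (w ! l) (drop (Suc l) w) * ?y (take l w) $ i)
        + (\<Sum>l<length w. if l = 0 then if w = w0 then z $ i else 0 else 0)"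
      by (simp add: word_deriv_expansion[OF X Hs v i] sum.distrib del: index_mult_mat_vec)
    then show ?thesis using i w0(2,3) by (auto simp: S_def simp del: index_mult_mat_vec)
  qed
  have "nc_deriv n p X H *\<^sub>v v = 0\<^sub>v n"
  proof (rule eq_vecI)
    fix i assume "i < dim_vec (0\<^sub>v n :: real Matrix.vec)"
    then have i: "i < n" by simp
    have "(nc_deriv n p X H *\<^sub>v v) $ i = (\<Sum>w\<in>?K. ?p w * (S w $ i + (if w = w0 then z $ i else 0)))"
      using X Hs v i deg
      by (simp add: nc_deriv_eq_wsum wsum_mult_vec deriv_w del: index_mult_mat_vec)
    also have "\<dots> = (\<Sum>w\<in>?K. ?p w * S w $ i) + ?p w0 * z $ i"
      using w0(1) by (simp add: distrib_left sum.distrib if_distrib[of "(*) _"] cong: if_cong)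
    also have "?p w0 * z $ i = - (\<Sum>w\<in>?K. ?p w * S w $ i)"
      using i p0 by (simp add: z_def sum_distrib_left sum_negf)
    finally show "(nc_deriv n p X H *\<^sub>v v) $ i = (0\<^sub>v n :: real Matrix.vec) $ i" using i by simp
  qed (simp add: nc_deriv_def)
  from curv[OF Hs this] have "(\<Sum>w\<in>?K. ?p w * scalar_prod (word_deriv2 n X H w *\<^sub>v v) v) \<le> 0"
    using X Hs v by (simp add: nc_deriv2_eq_wsum wsum_scalar_prod)
  moreover have "scalar_prod (word_deriv2 n X H w *\<^sub>v v) v = 2 * split_form (\<lambda>b. scalar_prod (?y b) y) \<gamma> \<gamma> w"
    if w: "w \<in> ?K" for w
  proof -
    \<comment> \<open>A prefix of length \<open>d - 1\<close> leaves no letter for the second derivative, so the vector \<open>z\<close>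
      never enters the Hessian.\<close>
    have letter: "2 * scalar_prod (word_deriv n X H (drop (Suc k) w) *\<^sub>v v) (H (w ! k) *\<^sub>v ?u (rev (take k w) @ [])) =
      2 * (\<Sum>m<length w - Suc k. \<gamma> (w ! k) (rev (take k w)) * \<gamma> (w ! (Suc k + m)) (drop (Suc (Suc k + m)) w)
         * scalar_prod (?y (take m (drop (Suc k) w))) y)" if k: "k < length w" for k
    proof (cases "Suc k < d")
      case True
      have len: "length (drop (Suc k) w) < d" using k deg[OF w] by simp
      have "word_deriv n X H (drop (Suc k) w) *\<^sub>v v = S (drop (Suc k) w)"
        using deriv_w[of "drop (Suc k) w"] len w0(2) S carrier_vecD[OF D]
        by (intro eq_vecI) (auto simp: S_def simp del: index_mult_mat_vec dim_mult_mat_vec)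
      moreover have "H (w ! k) *\<^sub>v ?u (rev (take k w)) = \<gamma> (w ! k) (rev (take k w)) \<cdot>\<^sub>v y"
        using True k by (subst H(3)) (auto simp: h_def)
      ultimately show ?thesis
        using S y k by (simp add: S_prod[OF y] sum_distrib_left ac_simps)
    next
      case False
      then have "drop (Suc k) w = []" using k deg[OF w] by simp
      moreover have "0\<^sub>m n n *\<^sub>v v = 0\<^sub>v n" using v by (intro eq_vecI) auto
      moreover have "H (w ! k) *\<^sub>v ?u (rev (take k w) @ []) \<in> carrier_vec n"
        using Hs u by simp
      moreover have "length w - Suc k = 0" using k deg[OF w] False by simp
      ultimately show ?thesis by simp
    qed
    have "scalar_prod (word_deriv2 n X H w *\<^sub>v v) (?u []) = 2 * split_form (\<lambda>b. scalar_prod (?y b) y) \<gamma> \<gamma> w"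
      unfolding word_deriv2_expansion[OF X Hs v] split_form_def
      unfolding sum_distrib_left[of 2 _ "{..<length w}"] by (rule sum.cong[OF refl], rule letter) simp
    then show ?thesis using v by simp
  qed
  ultimately have "2 * (\<Sum>w\<in>?K. ?p w * split_form (\<lambda>b. scalar_prod (?y b) y) \<gamma> \<gamma> w) \<le> 0"
    by (simp add: sum_distrib_left mult.left_commute)
  then show ?thesis by simp
qed

section \<open>Points at which words are independent\<close>

lemma nc_eval_mult_vec_index:
  assumes X: "X \<in> sym_tuples n" and v: "v \<in> carrier_vec n" and i: "i < n"
    and S: "finite S" "Poly_Mapping.keys q \<subseteq> S"
  shows "(nc_eval n q X *\<^sub>v v) $ i = (\<Sum>w\<in>S. Poly_Mapping.lookup q w * (word_eval n X w *\<^sub>v v) $ i)"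
proof -
  have "(nc_eval n q X *\<^sub>v v) $ i =
      (\<Sum>w\<in>Poly_Mapping.keys q. Poly_Mapping.lookup q w * (word_eval n X w *\<^sub>v v) $ i)"
    unfolding nc_eval_eq_wsum by (rule wsum_mult_vec) (use X v i in auto)
  also have "\<dots> = (\<Sum>w\<in>S. Poly_Mapping.lookup q w * (word_eval n X w *\<^sub>v v) $ i)"
    by (rule sum.mono_neutral_left) (use S in \<open>auto simp: in_keys_iff\<close>)
  finally show ?thesis .
qed

lemma length_le_nc_degree: "w \<in> Poly_Mapping.keys p \<Longrightarrow> length w \<le> nc_degree p"
  by (simp add: nc_degree_def)

lemma nc_degree_attained:
  assumes "nc_degree p > 0"
  shows "\<exists>w\<in>Poly_Mapping.keys p. length w = nc_degree p"
proof -
  have "nc_degree p \<in> insert 0 (length ` Poly_Mapping.keys p)"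
    unfolding nc_degree_def by (rule Max_in) auto
  then show ?thesis using assms by auto
qed

lemma lookup_rev_symmetric:
  assumes "nc_symmetric p"
  shows "Poly_Mapping.lookup p (rev w) = Poly_Mapping.lookup p w"
proof -
  have "Poly_Mapping.lookup (nc_transpose p) w = Poly_Mapping.lookup p (rev w)"
    unfolding nc_transpose_def by (simp add: map_key.rep_eq)
  then show ?thesis using assms by (simp add: nc_symmetric_def)
qed

text \<open>A linear relation among the vectors \<open>w(Y) u\<close>, with the words \<open>w\<close> shorter than the degree of
  \<open>p\<close>, is a nonzero polynomial \<open>q\<close> of smaller degree with \<open>q(Y) u = 0\<close>. Minimality of the degree of \<open>p\<close>
  therefore forbids that it holds at all points.\<close>

lemma min_degree_relation_fails:
  assumes min: "min_degree_defining p R" and T: "finite T" "\<And>w. w \<in> T \<Longrightarrow> length w < nc_degree p"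
    and c: "t \<in> T" "c t \<noteq> 0"
  shows "\<exists>(Y, u)\<in>R. \<exists>i<dim_vec u. (\<Sum>w\<in>T. c w * (word_eval (dim_vec u) Y w *\<^sub>v u) $ i) \<noteq> 0"
proof (rule ccontr)
  assume contra: "\<not> ?thesis"
  define q where "q = Abs_poly_mapping (\<lambda>w. if w \<in> T then c w else 0)"
  have lookup_q: "Poly_Mapping.lookup q w = (if w \<in> T then c w else 0)" for w
  proof -
    have "finite {w. (if w \<in> T then c w else 0) \<noteq> 0}"
      by (rule finite_subset[OF _ T(1)]) auto
    then show ?thesis unfolding q_def by (simp add: Abs_poly_mapping_inverse)
  qed
  have keys_q: "Poly_Mapping.keys q \<subseteq> T" by (auto simp: in_keys_iff lookup_q split: if_splits)
  have "q \<noteq> 0" using c lookup_q[of t] by auto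
  moreover have "nc_eval (dim_vec u) q Y *\<^sub>v u = 0\<^sub>v (dim_vec u)" if "(Y, u) \<in> R" for Y u
  proof (rule eq_vecI)
    fix i assume "i < dim_vec (0\<^sub>v (dim_vec u) :: real Matrix.vec)"
    then have i: "i < dim_vec u" by simp
    have "(Y, u) \<in> nc_variety p" using that min by (auto simp: min_degree_defining_def)
    then have Y: "Y \<in> sym_tuples (dim_vec u)" by (auto simp: nc_variety_def nc_variety_at_def)
    have "(nc_eval (dim_vec u) q Y *\<^sub>v u) $ i =
        (\<Sum>w\<in>T. c w * (word_eval (dim_vec u) Y w *\<^sub>v u) $ i)"
      by (simp add: nc_eval_mult_vec_index[OF Y _ i T(1) keys_q] lookup_q del: index_mult_mat_vec)
    then show "(nc_eval (dim_vec u) q Y *\<^sub>v u) $ i = (0\<^sub>v (dim_vec u) :: real Matrix.vec) $ i"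
      using contra that i by (auto simp del: index_mult_mat_vec)
  qed (simp add: nc_eval_def)
  ultimately have "nc_degree p \<le> nc_degree q" using min by (auto simp: min_degree_defining_def)
  moreover have "nc_degree q < nc_degree p"
    using T(2) keys_q T(2)[OF c(1)] by (auto simp: nc_degree_def)
  ultimately show False by simp
qed

lemma word_eval_dsum_mult_vec_index:
  assumes X: "X \<in> sym_tuples n" and Y: "Y \<in> sym_tuples m" and v: "v \<in> carrier_vec n" and u: "u \<in> carrier_vec m"
    and i: "i < n + m"
  shows "(word_eval (n + m) (tuple_dsum X Y) w *\<^sub>v (v @\<^sub>v u)) $ i =
    (if i < n then (word_eval n X w *\<^sub>v v) $ i else (word_eval m Y w *\<^sub>v u) $ (i - n))"
proof -
  have "word_eval (n + m) (tuple_dsum X Y) w *\<^sub>v (v @\<^sub>v u) = (word_eval n X w *\<^sub>v v) @\<^sub>v (word_eval m Y w *\<^sub>v u)"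
    unfolding word_eval_dsum[OF X Y] by (rule mat_dsum_mult_vec) (use X Y v u in auto)
  moreover have "dim_vec (word_eval n X w *\<^sub>v v) = n" "dim_vec (word_eval m Y w *\<^sub>v u) = m"
    using carrier_vecD[OF word_mult_vec_carrier[OF X v]] carrier_vecD[OF word_mult_vec_carrier[OF Y u]] .
  ultimately show ?thesis
    using i by (simp del: index_mult_mat_vec dim_mult_mat_vec)
qed

lemma relation_dsumD:
  assumes X: "X \<in> sym_tuples n" and Y: "Y \<in> sym_tuples m" and v: "v \<in> carrier_vec n" and u: "u \<in> carrier_vec m"
    and rel: "\<And>i. i < n + m \<Longrightarrow> (\<Sum>w\<in>T. c w * (word_eval (n + m) (tuple_dsum X Y) w *\<^sub>v (v @\<^sub>v u)) $ i) = 0"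
  shows "i < n \<Longrightarrow> (\<Sum>w\<in>T. c w * (word_eval n X w *\<^sub>v v) $ i) = 0"
    and "i < m \<Longrightarrow> (\<Sum>w\<in>T. c w * (word_eval m Y w *\<^sub>v u) $ i) = 0"
  using rel[of i] rel[of "n + i"]
  by (simp_all add: word_eval_dsum_mult_vec_index[OF X Y v u] del: index_mult_mat_vec)

lemma vec_independent_dsum:
  assumes X: "X \<in> sym_tuples n" and Y: "Y \<in> sym_tuples m" and v: "v \<in> carrier_vec n" and u: "u \<in> carrier_vec m"
    and ind: "vec_independent n (\<lambda>w. word_eval n X w *\<^sub>v v) T"
  shows "vec_independent (n + m) (\<lambda>w. word_eval (n + m) (tuple_dsum X Y) w *\<^sub>v (v @\<^sub>v u)) T"
  using ind relation_dsumD(1)[OF X Y v u, where T = T] unfolding vec_independent_def by blast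

text \<open>Each short relation fails at some point, and a relation at a direct sum holds at both summands.
  Adding words one at a time and, if needed, a summand that kills the new relation leaves no relation
  at a suitable direct sum.\<close>

lemma exists_independent_point:
  fixes p :: "'g::finite ncpoly"
  assumes O: "nc_basic_open_semialgebraic \<O>" and min: "min_degree_defining p (full_rank_points_in p \<O>)"
    and "finite S" "\<And>w. w \<in> S \<Longrightarrow> length w < nc_degree p"
  shows "\<exists>(X, v)\<in>full_rank_points_in p \<O>.
    vec_independent (dim_vec v) (\<lambda>w. word_eval (dim_vec v) X w *\<^sub>v v) S"
  using assms(3,4)
proof (induction S rule: finite_induct)
  case empty
  have "full_rank_points_in p \<O> \<noteq> {}" using min by (simp add: min_degree_defining_def)
  then show ?case by (auto simp: vec_independent_def)
next
  case (insert t S)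
  obtain X v where P: "(X, v) \<in> full_rank_points_in p \<O>"
    and ind: "vec_independent (dim_vec v) (\<lambda>w. word_eval (dim_vec v) X w *\<^sub>v v) S"
    using insert by auto
  define n where "n = dim_vec v"
  have v: "v \<in> carrier_vec n" and X: "X \<in> sym_tuples n"
    using full_rank_points_inD[OF P] by (simp_all add: n_def)
  show ?case
  proof (cases "vec_independent n (\<lambda>w. word_eval n X w *\<^sub>v v) (insert t S)")
    case True
    then show ?thesis using P by (auto simp: n_def)
  next
    case False
    then obtain c s where c: "\<And>i. i < n \<Longrightarrow> (\<Sum>w\<in>insert t S. c w * (word_eval n X w *\<^sub>v v) $ i) = 0"
      and s: "s \<in> insert t S" "c s \<noteq> 0"
      unfolding vec_independent_def by blast
    have ind': "\<forall>w\<in>S. b w = 0" if "\<And>i. i < n \<Longrightarrow> (\<Sum>w\<in>S. b w * (word_eval n X w *\<^sub>v v) $ i) = 0" for b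
      using ind that unfolding vec_independent_def n_def by blast
    have ct: "c t \<noteq> 0"
    proof
      assume ct: "c t = 0"
      have "\<forall>w\<in>S. c w = 0"
        by (rule ind') (use c insert.hyps ct in \<open>simp del: index_mult_mat_vec\<close>)
      then show False using ct s by auto
    qed
    obtain Y u i0 where Q: "(Y, u) \<in> full_rank_points_in p \<O>" and i0: "i0 < dim_vec u"
      "(\<Sum>w\<in>insert t S. c w * (word_eval (dim_vec u) Y w *\<^sub>v u) $ i0) \<noteq> 0"
      using min_degree_relation_fails[OF min, of "insert t S" s c] insert.prems insert.hyps(1) s by auto
    define m where "m = dim_vec u"
    have u: "u \<in> carrier_vec m" and Y: "Y \<in> sym_tuples m"
      using full_rank_points_inD[OF Q] by (simp_all add: m_def)
    \<comment> \<open>Up to a factor, \<open>c\<close> is the only relation at \<open>(X, v)\<close>, and it fails at \<open>(Y, u)\<close>.\<close>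
    have "vec_independent (n + m) (\<lambda>w. word_eval (n + m) (tuple_dsum X Y) w *\<^sub>v (v @\<^sub>v u)) (insert t S)"
      unfolding vec_independent_def
    proof (intro allI impI)
      fix r assume r: "\<forall>i<n + m. (\<Sum>w\<in>insert t S. r w * (word_eval (n + m) (tuple_dsum X Y) w *\<^sub>v (v @\<^sub>v u)) $ i) = 0"
      have rX: "(\<Sum>w\<in>insert t S. r w * (word_eval n X w *\<^sub>v v) $ i) = 0" if "i < n" for i
        by (rule relation_dsumD(1)[OF X Y v u _ that]) (use r in blast)
      have rY: "(\<Sum>w\<in>insert t S. r w * (word_eval m Y w *\<^sub>v u) $ i) = 0" if "i < m" for i
        by (rule relation_dsumD(2)[OF X Y v u _ that]) (use r in blast)
      define a where "a = r t / c t"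
      have "\<forall>w\<in>S. r w - a * c w = 0"
      proof (rule ind')
        fix i assume i: "i < n"
        have "(\<Sum>w\<in>insert t S. (r w - a * c w) * (word_eval n X w *\<^sub>v v) $ i) =
            (\<Sum>w\<in>insert t S. r w * (word_eval n X w *\<^sub>v v) $ i) - a * (\<Sum>w\<in>insert t S. c w * (word_eval n X w *\<^sub>v v) $ i)"
          by (simp only: sum_subtractf sum_distrib_left left_diff_distrib mult.assoc)
        also have "\<dots> = 0" by (simp only: rX[OF i] c[OF i])
        finally show "(\<Sum>w\<in>S. (r w - a * c w) * (word_eval n X w *\<^sub>v v) $ i) = 0"
          using insert.hyps ct by (simp add: a_def del: index_mult_mat_vec)
      qed
      then have r_eq: "r w = a * c w" if "w \<in> insert t S" for w
        using that ct by (auto simp: a_def)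
      have "0 = (\<Sum>w\<in>insert t S. a * c w * (word_eval m Y w *\<^sub>v u) $ i0)"
        using rY[of i0] i0(1) by (simp only: m_def r_eq cong: sum.cong)
      also have "\<dots> = a * (\<Sum>w\<in>insert t S. c w * (word_eval m Y w *\<^sub>v u) $ i0)"
        by (simp only: sum_distrib_left mult.assoc)
      finally have "a = 0" using i0(2) by (simp add: m_def del: index_mult_mat_vec)
      then show "\<forall>w\<in>insert t S. r w = 0" using r_eq by simp
    qed
    then show ?thesis
      using full_rank_points_in_dsum[OF O P Q] by (intro bexI[of _ "(tuple_dsum X Y, v @\<^sub>v u)"]) (auto simp: n_def m_def)
  qed
qed

lemma scalar_prod_self_pos:
  fixes v :: "real Matrix.vec"
  assumes "v \<in> carrier_vec n" "v \<noteq> 0\<^sub>v n"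
  shows "scalar_prod v v > 0"
proof -
  obtain i where "i < n" "v $ i \<noteq> 0" using assms by (metis carrier_vecD eq_vecI index_zero_vec)
  then show ?thesis
    using assms(1) unfolding scalar_prod_def by (intro sum_pos2[of _ i]) (auto simp: zero_less_mult_iff neq_iff)
qed

text \<open>Doubling a point to \<open>(X \<oplus> X, v \<oplus> v)\<close> keeps all short words independent and provides the nonzero
  vector \<open>y = v \<oplus> -v\<close>, which is orthogonal to every \<open>w(X) v \<oplus> w(X) v\<close>. The
  number \<open>G([])\<close> is then \<open>\<langle>y, y\<rangle>\<close>.\<close>

lemma exists_nonpos_split_form:
  fixes p :: "'g::finite ncpoly"
  assumes O: "nc_basic_open_semialgebraic \<O>"
    and curv: "\<forall>P\<in>full_rank_points_in p \<O>. positive_curvature_at p P"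
    and min: "min_degree_defining p (full_rank_points_in p \<O>)" and d: "nc_degree p > 0"
  shows "\<exists>G. G [] > (0::real) \<and> (\<forall>\<gamma>. (\<forall>i c. nc_degree p \<le> Suc (length c) \<longrightarrow> \<gamma> i c = 0) \<longrightarrow>
    (\<Sum>w\<in>Poly_Mapping.keys p. Poly_Mapping.lookup p w * split_form G \<gamma> \<gamma> w) \<le> 0)"
proof -
  let ?S = "{c :: 'g list. length c < nc_degree p}"
  obtain X v where P: "(X, v) \<in> full_rank_points_in p \<O>"
    and ind: "vec_independent (dim_vec v) (\<lambda>w. word_eval (dim_vec v) X w *\<^sub>v v) ?S"
    using exists_independent_point[OF O min finite_words_less[of "nc_degree p"]] by auto
  define n where "n = dim_vec v"
  have v: "v \<in> carrier_vec n" and X: "X \<in> sym_tuples n"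
    using full_rank_points_inD[OF P] by (simp_all add: n_def)
  define XX where "XX = tuple_dsum X X"
  define vv where "vv = v @\<^sub>v v"
  define y where "y = v @\<^sub>v (- v)"
  have XX: "XX \<in> sym_tuples (n + n)" and vv: "vv \<in> carrier_vec (n + n)" and y: "y \<in> carrier_vec (n + n)"
    using X v by (simp_all add: XX_def vv_def y_def)
  have "v \<noteq> 0\<^sub>v n"
  proof
    assume "v = 0\<^sub>v n"
    then have "word_eval n X w *\<^sub>v v = 0\<^sub>v n" for w
      using word_eval_carrier[OF X, of w] by (intro eq_vecI) auto
    then have "(\<Sum>w\<in>?S. 1 * (word_eval n X w *\<^sub>v v) $ i) = 0" if "i < n" for i
      using that by (simp del: index_mult_mat_vec)
    then have "\<forall>w\<in>?S. (1::real) = 0"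
      using spec[OF ind[folded n_def, unfolded vec_independent_def], of "\<lambda>_. 1"] by blast
    then have "(1::real) = 0" by (rule bspec[where x = "[]"]) (use d in simp)
    then show False by simp
  qed
  then have y_pos: "scalar_prod y y > 0"
    using scalar_prod_self_pos[OF v] v by (simp add: y_def scalar_prod_append[of _ n _ n])
  have orth: "scalar_prod y (word_eval (n + n) XX w *\<^sub>v vv) = 0" for w
  proof -
    have "word_eval (n + n) XX w *\<^sub>v vv = (word_eval n X w *\<^sub>v v) @\<^sub>v (word_eval n X w *\<^sub>v v)"
      unfolding XX_def vv_def word_eval_dsum[OF X X] by (rule mat_dsum_mult_vec) (use X v in auto)
    then show ?thesis
      using word_mult_vec_carrier[OF X v, of w] v
        uminus_scalar_prod[OF v word_mult_vec_carrier[OF X v, of w]]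
      by (simp add: y_def scalar_prod_append[of _ n _ n])
  qed
  have PP: "(XX, vv) \<in> full_rank_points_in p \<O>"
    unfolding XX_def vv_def by (rule full_rank_points_in_dsum[OF O P P])
  have dim_vv: "dim_vec vv = n + n" using vv by simp
  obtain w0 where w0: "w0 \<in> Poly_Mapping.keys p" "length w0 = nc_degree p"
    using nc_degree_attained[OF d] by auto
  have "(\<Sum>w\<in>Poly_Mapping.keys p. Poly_Mapping.lookup p w *
      split_form (\<lambda>b. scalar_prod (word_eval (n + n) XX b *\<^sub>v y) y) \<gamma> \<gamma> w) \<le> 0"
    if "\<forall>i c. nc_degree p \<le> Suc (length c) \<longrightarrow> \<gamma> i c = 0" for \<gamma>
  proof (rule curvature_split_form_nonpos[OF XX vv y _ orth w0 d length_le_nc_degree])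
    show "vec_independent (n + n) (\<lambda>w. word_eval (n + n) XX w *\<^sub>v vv) ?S"
      unfolding XX_def vv_def by (rule vec_independent_dsum[OF X X v v]) (use ind in \<open>simp add: n_def\<close>)
    show "scalar_prod (nc_deriv2 (n + n) p XX H *\<^sub>v vv) vv \<le> 0"
      if "H \<in> sym_tuples (n + n)" "nc_deriv (n + n) p XX H *\<^sub>v vv = 0\<^sub>v (n + n)" for H
      using bspec[OF curv PP] that by (auto simp: positive_curvature_at_def clamped_tangent_def dim_vv)
  qed (use that in auto)
  moreover have "scalar_prod (word_eval (n + n) XX [] *\<^sub>v y) y > 0" using y y_pos by simp
  ultimately show ?thesis
    by (intro exI[of _ "\<lambda>b. scalar_prod (word_eval (n + n) XX b *\<^sub>v y) y"]) auto
qed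

section \<open>The degree is at most two\<close>

lemma split_form_line:
  "split_form G (\<lambda>i c. \<epsilon> * \<alpha> i c + \<beta> i c) (\<lambda>i c. \<epsilon> * \<alpha> i c + \<beta> i c) w =
     \<epsilon>\<^sup>2 * split_form G \<alpha> \<alpha> w + \<epsilon> * (split_form G \<alpha> \<beta> w + split_form G \<beta> \<alpha> w) + split_form G \<beta> \<beta> w"
  unfolding split_form_def sum_distrib_left sum.distrib[symmetric]
  by (intro sum.cong refl) (simp add: algebra_simps power2_eq_square)

definition word_indicator :: "'g \<Rightarrow> 'g list \<Rightarrow> 'g \<Rightarrow> 'g list \<Rightarrow> real" where
  "word_indicator i0 c0 = (\<lambda>i c. if i = i0 \<and> c = c0 then 1 else 0)"

lemma split_form_single:
  assumes "\<And>k m. k < length w \<Longrightarrow> m < length w - Suc k \<Longrightarrow> (k, m) \<noteq> (k0, m0) \<Longrightarrow>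
      \<gamma> (w ! k) (rev (take k w)) * \<delta> (w ! (Suc k + m)) (drop (Suc (Suc k + m)) w) = 0"
    and "k0 < length w" "m0 < length w - Suc k0"
  shows "split_form G \<gamma> \<delta> w = \<gamma> (w ! k0) (rev (take k0 w)) *
    \<delta> (w ! (Suc k0 + m0)) (drop (Suc (Suc k0 + m0)) w) * G (take m0 (drop (Suc k0) w))"
proof -
  let ?T = "\<lambda>k m. \<gamma> (w ! k) (rev (take k w)) * \<delta> (w ! (Suc k + m)) (drop (Suc (Suc k + m)) w)
      * G (take m (drop (Suc k) w))"
  have "split_form G \<gamma> \<delta> w = (\<Sum>k<length w. \<Sum>m<length w - Suc k. if m = m0 then if k = k0 then ?T k0 m0 else 0 else 0)"
    unfolding split_form_def using assms(1) by (intro sum.cong refl) auto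
  also have "\<dots> = (\<Sum>k<length w. if k = k0 then ?T k0 m0 else 0)"
    using assms(3) by (intro sum.cong refl) auto
  also have "\<dots> = ?T k0 m0" using assms(2) by simp
  finally show ?thesis .
qed

lemma split_form_zero:
  assumes "\<And>k m. k < length w \<Longrightarrow> m < length w - Suc k \<Longrightarrow>
      \<gamma> (w ! k) (rev (take k w)) * \<delta> (w ! (Suc k + m)) (drop (Suc (Suc k + m)) w) = 0"
  shows "split_form G \<gamma> \<delta> w = 0"
  unfolding split_form_def using assms by (intro sum.neutral ballI) simp

text \<open>The prefix must be empty and the suffix \<open>c0\<close>; the bound on the length of \<open>w\<close> then leaves no
  room for a middle factor, and \<open>w\<close> is determined. The next lemma is the mirror image.\<close>

lemma split_form_first:
  assumes w: "length w \<le> Suc (Suc (length c0))"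
  shows "split_form G (word_indicator i0 []) (word_indicator j0 c0) w =
    (if w = i0 # j0 # c0 then G [] else 0)"
proof (cases "w = i0 # j0 # c0")
  case True
  have "split_form G (word_indicator i0 []) (word_indicator j0 c0) w = 
    word_indicator i0 [] (w ! 0) (rev (take 0 w)) *
    word_indicator j0 c0 (w ! (Suc 0 + 0)) (drop (Suc (Suc 0 + 0)) w) * G (take 0 (drop (Suc 0) w))"
  proof (rule split_form_single)
    fix k m assume km: "k < length w" "m < length w - Suc k" "(k, m) \<noteq> (0, 0)"
    show "word_indicator i0 [] (w ! k) (rev (take k w)) *
        word_indicator j0 c0 (w ! (Suc k + m)) (drop (Suc (Suc k + m)) w) = 0"
    proof (cases "k = 0")
      case True
      then have "length (drop (Suc (Suc k + m)) w) \<noteq> length c0"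
        using km w by simp
      then show ?thesis by (auto simp: word_indicator_def)
    qed (use km in \<open>auto simp: word_indicator_def\<close>)
  qed (use True in auto)
  then show ?thesis using True by (simp add: word_indicator_def)
next
  case False
  have "split_form G (word_indicator i0 []) (word_indicator j0 c0) w = 0"
  proof (rule split_form_zero, rule ccontr)
    fix k m assume km: "k < length w" "m < length w - Suc k"
      "word_indicator i0 [] (w ! k) (rev (take k w)) *
        word_indicator j0 c0 (w ! (Suc k + m)) (drop (Suc (Suc k + m)) w) \<noteq> 0"
    then have k: "k = 0" "w ! 0 = i0" and j: "w ! Suc m = j0" "drop (Suc (Suc m)) w = c0"
      by (auto simp: word_indicator_def split: if_splits)
    have "length (drop (Suc (Suc m)) w) = length c0" using j(2) by simp
    then have "m = 0" using km(2) w k by simp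
    moreover have "w = w ! 0 # w ! 1 # drop 2 w"
      using km(1,2) k by (cases w; cases "tl w") auto
    ultimately show False using k j False by (simp add: numeral_2_eq_2)
  qed
  then show ?thesis using False by simp
qed

lemma split_form_last:
  assumes w: "length w \<le> Suc (Suc (length c0))"
  shows "split_form G (word_indicator j0 c0) (word_indicator i0 []) w =
    (if w = rev (i0 # j0 # c0) then G [] else 0)"
proof (cases "w = rev (i0 # j0 # c0)")
  case True
  let ?k = "length c0"
  have "split_form G (word_indicator j0 c0) (word_indicator i0 []) w = 
    word_indicator j0 c0 (w ! ?k) (rev (take ?k w)) *
    word_indicator i0 [] (w ! (Suc ?k + 0)) (drop (Suc (Suc ?k + 0)) w) * G (take 0 (drop (Suc ?k) w))"
  proof (rule split_form_single)
    fix k m assume km: "k < length w" "m < length w - Suc k" "(k, m) \<noteq> (?k, 0)"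
    show "word_indicator j0 c0 (w ! k) (rev (take k w)) *
        word_indicator i0 [] (w ! (Suc k + m)) (drop (Suc (Suc k + m)) w) = 0"
    proof (cases "k = ?k")
      case False
      then have "length (rev (take k w)) \<noteq> length c0"
        using km by simp
      then show ?thesis by (auto simp: word_indicator_def)
    qed (use km w in \<open>auto simp: word_indicator_def\<close>)
  qed (use True in auto)
  then show ?thesis using True by (simp add: word_indicator_def nth_append)
next
  case False
  have "split_form G (word_indicator j0 c0) (word_indicator i0 []) w = 0"
  proof (rule split_form_zero, rule ccontr)
    fix k m assume km: "k < length w" "m < length w - Suc k"
      "word_indicator j0 c0 (w ! k) (rev (take k w)) *
        word_indicator i0 [] (w ! (Suc k + m)) (drop (Suc (Suc k + m)) w) \<noteq> 0"
    then have j: "w ! k = j0" "rev (take k w) = c0" and i: "w ! (Suc k + m) = i0" "length w \<le> Suc (Suc k + m)"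
      by (auto simp: word_indicator_def split: if_splits)
    have k: "k = length c0" using j(2) km(1) by auto
    then have m: "m = 0" "length w = Suc (Suc k)" using km(2) w i(2) by auto
    have "w = take k w @ drop k w" by simp
    also have "drop k w = [w ! k, w ! Suc k]"
      using m(2) by (simp add: Cons_nth_drop_Suc[symmetric])
    also have "take k w = rev c0" using j(2) by auto
    finally show False using j(1) i(1) m(1) False by simp
  qed
  then show ?thesis using False by simp
qed

text \<open>If a word \<open>x\<^sub>i x\<^sub>j c\<close> of length at least 3 had maximal length, take the coordinates \<open>\<epsilon>\<close> at
  \<open>(i, [])\<close> and 1 at \<open>(j, c)\<close>. By degree reasons the form has no term in \<open>(j, c)\<close> alone.
  What remains is \<open>\<epsilon>\<^sup>2 A + \<epsilon> B\<close>, where \<open>B\<close> is a nonzero multiple of the coefficient of the word: the word and its reversal contribute equally because \<open>p\<close> is symmetric. Such an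
  expression takes positive values.\<close>

lemma nonpos_split_form_degree_le_2:
  fixes p :: "'g::finite ncpoly"
  assumes sym: "nc_symmetric p" and G: "G [] > (0::real)"
    and nonpos: "\<And>\<gamma>. (\<And>i c. nc_degree p \<le> Suc (length c) \<Longrightarrow> \<gamma> i c = 0) \<Longrightarrow>
      (\<Sum>w\<in>Poly_Mapping.keys p. Poly_Mapping.lookup p w * split_form G \<gamma> \<gamma> w) \<le> 0"
  shows "nc_degree p \<le> 2"
proof (rule ccontr)
  assume "\<not> nc_degree p \<le> 2"
  then have d: "nc_degree p \<ge> 3" by simp
  let ?p = "Poly_Mapping.lookup p" and ?K = "Poly_Mapping.keys p"
  obtain w0 where w0: "w0 \<in> ?K" "length w0 = nc_degree p"
    using nc_degree_attained[of p] d by auto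
  then obtain i0 j0 c0 where w0_eq: "w0 = i0 # j0 # c0"
    using d by (cases w0; cases "tl w0") auto
  have c0: "nc_degree p = Suc (Suc (length c0))" "length c0 \<ge> 1" using w0(2) w0_eq d by auto
  define \<alpha> where "\<alpha> = word_indicator i0 []"
  define \<beta> where "\<beta> = word_indicator j0 c0"
  define A where "A = (\<Sum>w\<in>?K. ?p w * split_form G \<alpha> \<alpha> w)"
  define B where "B = 2 * ?p w0 * G []"
  have p0: "?p w0 \<noteq> 0" using w0(1) by (simp add: in_keys_iff)
  have rev_p0: "?p (rev w0) = ?p w0" by (rule lookup_rev_symmetric[OF sym])
  then have rev_w0: "rev w0 \<in> ?K" using p0 by (simp add: in_keys_iff)
  have \<beta>\<beta>: "split_form G \<beta> \<beta> w = 0" if "w \<in> ?K" for w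
  proof (rule split_form_zero, rule ccontr)
    fix k m assume km: "k < length w" "m < length w - Suc k"
      "\<beta> (w ! k) (rev (take k w)) * \<beta> (w ! (Suc k + m)) (drop (Suc (Suc k + m)) w) \<noteq> 0"
    then have "rev (take k w) = c0" "drop (Suc (Suc k + m)) w = c0"
      by (auto simp: \<beta>_def word_indicator_def split: if_splits)
    then have "length (rev (take k w)) = length c0" "length (drop (Suc (Suc k + m)) w) = length c0"
      by simp_all
    then show False using km(1,2) length_le_nc_degree[OF that] c0 by simp
  qed
  have cross: "(\<Sum>w\<in>?K. ?p w * (split_form G \<alpha> \<beta> w + split_form G \<beta> \<alpha> w)) = B"
  proof -
    have "(\<Sum>w\<in>?K. ?p w * (split_form G \<alpha> \<beta> w + split_form G \<beta> \<alpha> w)) =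
        (\<Sum>w\<in>?K. (if w = w0 then ?p w * G [] else 0) + (if w = rev w0 then ?p w * G [] else 0))"
      using length_le_nc_degree[of _ p] c0(1)
      by (intro sum.cong refl) (auto simp: \<alpha>_def \<beta>_def split_form_first split_form_last w0_eq)
    also have "\<dots> = ?p w0 * G [] + ?p (rev w0) * G []"
      using w0(1) rev_w0 by (simp add: sum.distrib)
    finally show ?thesis by (simp add: rev_p0 B_def)
  qed
  have line: "\<epsilon>\<^sup>2 * A + \<epsilon> * B \<le> 0" for \<epsilon>
  proof -
    have "(\<Sum>w\<in>?K. ?p w * split_form G (\<lambda>i c. \<epsilon> * \<alpha> i c + \<beta> i c) (\<lambda>i c. \<epsilon> * \<alpha> i c + \<beta> i c) w) \<le> 0"
      by (rule nonpos) (use c0 in \<open>auto simp: \<alpha>_def \<beta>_def word_indicator_def\<close>)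
    also have "(\<Sum>w\<in>?K. ?p w * split_form G (\<lambda>i c. \<epsilon> * \<alpha> i c + \<beta> i c) (\<lambda>i c. \<epsilon> * \<alpha> i c + \<beta> i c) w)
        = (\<Sum>w\<in>?K. \<epsilon>\<^sup>2 * (?p w * split_form G \<alpha> \<alpha> w) + \<epsilon> * (?p w * (split_form G \<alpha> \<beta> w + split_form G \<beta> \<alpha> w)))"
      unfolding split_form_line by (intro sum.cong refl) (simp add: \<beta>\<beta> algebra_simps)
    also have "\<dots> = \<epsilon>\<^sup>2 * A + \<epsilon> * B"
      by (simp only: sum.distrib sum_distrib_left[symmetric] A_def cross)
    finally show ?thesis .
  qed
  \<comment> \<open>For small \<open>\<epsilon>\<close> with the sign of \<open>B\<close> the linear term dominates.\<close>
  define s where "s = 1 / (\<bar>A\<bar> + 1)"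
  have s: "s > 0" "s * A > -1" 
  proof -
    show "s > 0" by (simp add: s_def add_nonneg_pos)
    have "- A < \<bar>A\<bar> + 1" by simp
    then show "s * A > -1" by (simp add: s_def field_simps add_nonneg_pos)
  qed
  have "B \<noteq> 0" using p0 G by (simp add: B_def)
  have "(s * B)\<^sup>2 * A + (s * B) * B = s * B\<^sup>2 * (s * A + 1)"
    by (simp add: algebra_simps power2_eq_square)
  also have "\<dots> > 0" using s \<open>B \<noteq> 0\<close> by simp
  finally show False using line[of "s * B"] by simp
qed

section \<open>Concavity in degree two\<close>

lemma sum_keys_length_two:
  fixes p :: "'g::finite ncpoly"
  assumes "\<And>w. w \<in> Poly_Mapping.keys p \<Longrightarrow> length w \<noteq> 2 \<Longrightarrow> F w = 0"
  shows "(\<Sum>w\<in>Poly_Mapping.keys p. Poly_Mapping.lookup p w * F w) =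
    (\<Sum>i\<in>UNIV. \<Sum>j\<in>UNIV. Poly_Mapping.lookup p [i, j] * F [i, j])"
proof -
  let ?f = "\<lambda>w. Poly_Mapping.lookup p w * F w"
  let ?I = "(\<lambda>(i, j). [i, j]) ` (UNIV :: ('g \<times> 'g) set)"
  have "w \<in> ?I" if "length w = 2" for w :: "'g list"
    using that by (cases w; cases "tl w") (auto simp: image_iff)
  then have "sum ?f (Poly_Mapping.keys p) = sum ?f (?I \<inter> Poly_Mapping.keys p)"
    using assms by (intro sum.mono_neutral_right) auto
  also have "\<dots> = sum ?f ?I"
    by (intro sum.mono_neutral_left) (auto simp: in_keys_iff)
  also have "\<dots> = (\<Sum>x\<in>UNIV. ?f (case x of (i, j) \<Rightarrow> [i, j]))"
    by (subst sum.reindex) (auto simp: inj_on_def)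
  also have "\<dots> = (\<Sum>i\<in>UNIV. \<Sum>j\<in>UNIV. ?f [i, j])"
    by (simp add: sum.cartesian_product case_prod_unfold)
  finally show ?thesis .
qed

text \<open>In degree two the form in the coordinates at the level of the empty word is exactly the
  quadratic form of the coefficient matrix \<open>(p\<^sub>i\<^sub>j)\<close>, scaled by \<open>G([])\<close>.\<close>

lemma quadratic_coefficients_nonpos:
  fixes p :: "'g::finite ncpoly"
  assumes deg: "nc_degree p \<le> 2" and G: "G [] > (0::real)"
    and nonpos: "\<And>\<gamma>. (\<And>i c. nc_degree p \<le> Suc (length c) \<Longrightarrow> \<gamma> i c = 0) \<Longrightarrow>
      (\<Sum>w\<in>Poly_Mapping.keys p. Poly_Mapping.lookup p w * split_form G \<gamma> \<gamma> w) \<le> 0"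
  shows "(\<Sum>i\<in>UNIV. \<Sum>j\<in>UNIV. Poly_Mapping.lookup p [i, j] * (\<alpha> i * \<alpha> j)) \<le> 0"
proof (cases "nc_degree p = 2")
  case True
  define \<gamma> where "\<gamma> i c = (if c = [] then \<alpha> i else 0)" for i and c :: "'g list"
  have len: "length w \<le> 2" if "w \<in> Poly_Mapping.keys p" for w
    using length_le_nc_degree[OF that] deg by simp
  have short: "split_form G \<gamma> \<gamma> w = 0" if "length w < 2" for w
    using that by (intro split_form_zero) auto
  have two: "split_form G \<gamma> \<gamma> [i, j] = G [] * (\<alpha> i * \<alpha> j)" for i j
    by (simp add: split_form_def \<gamma>_def)
  have "(\<Sum>w\<in>Poly_Mapping.keys p. Poly_Mapping.lookup p w * split_form G \<gamma> \<gamma> w) \<le> 0"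
    by (rule nonpos) (use True in \<open>auto simp: \<gamma>_def\<close>)
  also have "(\<Sum>w\<in>Poly_Mapping.keys p. Poly_Mapping.lookup p w * split_form G \<gamma> \<gamma> w) =
      (\<Sum>i\<in>UNIV. \<Sum>j\<in>UNIV. Poly_Mapping.lookup p [i, j] * (G [] * (\<alpha> i * \<alpha> j)))"
    unfolding two[symmetric] by (rule sum_keys_length_two) (use len short in force)
  also have "\<dots> = G [] * (\<Sum>i\<in>UNIV. \<Sum>j\<in>UNIV. Poly_Mapping.lookup p [i, j] * (\<alpha> i * \<alpha> j))"
    by (simp add: sum_distrib_left mult.left_commute)
  finally show ?thesis using G by (simp add: mult_le_0_iff)
next
  case False
  then have "Poly_Mapping.lookup p [i, j] = 0" for i j
    using length_le_nc_degree[of "[i, j]" p] deg by (auto simp: in_keys_iff)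
  then show ?thesis by simp
qed

lemma nc_eval_transpose:
  assumes sym: "nc_symmetric p" and X: "X \<in> sym_tuples n"
  shows "transpose_mat (nc_eval n p X) = nc_eval n p X"
proof (rule eq_matI)
  fix i j assume "i < dim_row (nc_eval n p X)" "j < dim_col (nc_eval n p X)"
  then have ij: "i < n" "j < n" by (simp_all add: nc_eval_def)
  let ?f = "\<lambda>i j w. Poly_Mapping.lookup p w * word_eval n X w $$ (i, j)"
  have "word_eval n X w $$ (j, i) = word_eval n X (rev w) $$ (i, j)" for w
    using ij word_eval_carrier[OF X, of w] by (simp add: word_eval_transpose[OF X, symmetric])
  then have "(\<Sum>w\<in>Poly_Mapping.keys p. ?f j i w) = (\<Sum>w\<in>Poly_Mapping.keys p. ?f i j (rev w))"
    by (simp add: lookup_rev_symmetric[OF sym])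
  also have "\<dots> = (\<Sum>w\<in>Poly_Mapping.keys p. ?f i j w)"
    by (rule sum.reindex_bij_witness[of _ rev rev]) (auto simp: in_keys_iff lookup_rev_symmetric[OF sym])
  finally show "transpose_mat (nc_eval n p X) $$ (i, j) = nc_eval n p X $$ (i, j)"
    using ij by (simp add: nc_eval_def)
qed (simp_all add: nc_eval_def)

lemma nc_eval_scalar_prod:
  assumes "X \<in> sym_tuples n" "v \<in> carrier_vec n"
  shows "scalar_prod (nc_eval n p X *\<^sub>v v) v =
    (\<Sum>w\<in>Poly_Mapping.keys p. Poly_Mapping.lookup p w * scalar_prod (word_eval n X w *\<^sub>v v) v)"
  unfolding nc_eval_eq_wsum by (rule wsum_scalar_prod) (use assms in auto)

text \<open>For a quadratic polynomial, \<open>p(tX + (1 - t)Y) - t p(X) - (1 - t) p(Y)\<close> equals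
  \<open>-t(1 - t) \<Sum>\<^sub>i\<^sub>j p\<^sub>i\<^sub>j D\<^sub>i D\<^sub>j\<close> with \<open>D = X - Y\<close>. Up to the factor \<open>-t(1 - t)\<close>, its value at \<open>v\<close> is
  the sum over the entries \<open>k\<close> of the values of the quadratic form \<open>(p\<^sub>i\<^sub>j)\<close> at \<open>i \<mapsto> (D\<^sub>i v)\<^sub>k\<close>.\<close>

lemma quadratic_nc_concave:
  fixes p :: "'g::finite ncpoly"
  assumes sym: "nc_symmetric p" and deg: "nc_degree p \<le> 2"
    and neg: "\<And>\<alpha>. (\<Sum>i\<in>UNIV. \<Sum>j\<in>UNIV. Poly_Mapping.lookup p [i, j] * (\<alpha> i * \<alpha> j)) \<le> 0"
  shows "nc_concave p"
  unfolding nc_concave_def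
proof (intro allI impI ballI)
  fix n :: nat and X Y :: "'g \<Rightarrow> real mat" and t :: real
  assume X: "X \<in> sym_tuples n" and Y: "Y \<in> sym_tuples n" and t: "0 \<le> t \<and> t \<le> 1"
  define Z where "Z = (\<lambda>j. t \<cdot>\<^sub>m X j + (1 - t) \<cdot>\<^sub>m Y j)"
  let ?K = "Poly_Mapping.keys p" and ?p = "Poly_Mapping.lookup p"
  let ?M = "nc_eval n p Z - t \<cdot>\<^sub>m nc_eval n p X - (1 - t) \<cdot>\<^sub>m nc_eval n p Y"
  have smult_transpose: "transpose_mat (c \<cdot>\<^sub>m A) = c \<cdot>\<^sub>m transpose_mat A" for c :: real and A
    by (rule eq_matI) auto
  have Z: "Z \<in> sym_tuples n"
    using X Y unfolding sym_tuples_def Z_def by (auto simp: transpose_add[of _ n n] smult_transpose)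
  have M: "?M \<in> carrier_mat n n" by (intro minus_carrier_mat smult_carrier_mat nc_eval_carrier)
  have M_sym: "transpose_mat ?M = ?M"
    by (simp add: transpose_minus[of _ n n] smult_transpose nc_eval_transpose[OF sym] X Y Z minus_carrier_mat)
  have "scalar_prod (?M *\<^sub>v v) v \<ge> 0" if v: "v \<in> carrier_vec n" for v
  proof -
    define q where "q U w = scalar_prod (word_eval n U w *\<^sub>v v) v" for U :: "'g \<Rightarrow> real mat" and w
    define F where "F w = q Z w - t * q X w - (1 - t) * q Y w" for w
    let ?x = "\<lambda>i k. (X i *\<^sub>v v) $ k" and ?y = "\<lambda>i k. (Y i *\<^sub>v v) $ k"
    have z: "(Z i *\<^sub>v v) $ k = t * ?x i k + (1 - t) * ?y i k" if "k < n" for i k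
    proof -
      note car = sym_tuples_carrier[OF X, of i] sym_tuples_carrier[OF Y, of i]
      have entry: "Z i $$ (k, l) = t * X i $$ (k, l) + (1 - t) * Y i $$ (k, l)" if "l < n" for l
        using car that \<open>k < n\<close> by (simp add: Z_def)
      have "(\<Sum>l=0..<n. Z i $$ (k, l) * v $ l) =
          (\<Sum>l=0..<n. t * (X i $$ (k, l) * v $ l) + (1 - t) * (Y i $$ (k, l) * v $ l))"
        by (intro sum.cong refl) (simp add: entry distrib_right mult.assoc)
      then show ?thesis
        using that by (simp only: index_mult_mat_vec_sum[OF sym_tuples_carrier[OF X] v]
            index_mult_mat_vec_sum[OF sym_tuples_carrier[OF Y] v]
            index_mult_mat_vec_sum[OF sym_tuples_carrier[OF Z] v] sum.distrib sum_distrib_left)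
    qed
    have q1: "q U [i] = (\<Sum>k=0..<n. (U i *\<^sub>v v) $ k * v $ k)" if "U \<in> sym_tuples n" for U i
      using sym_tuples_carrier[OF that, of i] v
      by (simp add: q_def scalar_prod_def[of _ v] right_mult_one_mat[of _ n n])
    have q2: "q U [i, j] = (\<Sum>k=0..<n. (U j *\<^sub>v v) $ k * (U i *\<^sub>v v) $ k)" if U: "U \<in> sym_tuples n" for U i j
    proof -
      have "q U [i, j] = scalar_prod (U i *\<^sub>v (U j *\<^sub>v v)) v"
        using sym_tuples_carrier[OF U, of i] sym_tuples_carrier[OF U, of j] v
        by (simp add: q_def right_mult_one_mat[of _ n n] assoc_mult_mat_vec[of _ n n _ n])
      also have "\<dots> = scalar_prod (U j *\<^sub>v v) (U i *\<^sub>v v)"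
        by (rule sym_adjoint[OF U sym_mult_vec_carrier[OF U v] v])
      also have "\<dots> = (\<Sum>k=0..<n. (U j *\<^sub>v v) $ k * (U i *\<^sub>v v) $ k)"
        using carrier_vecD[OF sym_mult_vec_carrier[OF U v, of i]] by (simp only: scalar_prod_def)
      finally show ?thesis .
    qed
    have F_two: "F [i, j] = - (t * (1 - t)) * (\<Sum>k=0..<n. (?x i k - ?y i k) * (?x j k - ?y j k))" for i j
    proof -
      have "F [i, j] = (\<Sum>k=0..<n. (t * ?x j k + (1 - t) * ?y j k) * (t * ?x i k + (1 - t) * ?y i k))
          - t * (\<Sum>k=0..<n. ?x j k * ?x i k) - (1 - t) * (\<Sum>k=0..<n. ?y j k * ?y i k)"
        by (simp add: F_def q2 X Y Z z del: index_mult_mat_vec)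
      also have "\<dots> = (\<Sum>k=0..<n. - (t * (1 - t)) * ((?x i k - ?y i k) * (?x j k - ?y j k)))"
        unfolding sum_distrib_left sum_subtractf[symmetric]
        by (intro sum.cong refl) (simp add: algebra_simps del: index_mult_mat_vec)
      finally show ?thesis by (simp only: sum_distrib_left)
    qed
    have F_short: "F w = 0" if w: "w \<in> ?K" and len: "length w \<noteq> 2" for w
    proof -
      have "length w \<le> 2" using length_le_nc_degree[OF w] deg by simp
      then consider "w = []" | i where "w = [i]"
        using len by (cases w; cases "tl w") auto
      then show ?thesis
      proof cases
        case 1
        then show ?thesis by (simp add: F_def q_def algebra_simps)
      next
        case 2
        have "F w = (\<Sum>k=0..<n. (t * ?x i k + (1 - t) * ?y i k) * v $ k)
          - t * (\<Sum>k=0..<n. ?x i k * v $ k) - (1 - t) * (\<Sum>k=0..<n. ?y i k * v $ k)"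
          by (simp add: 2 F_def q1 X Y Z z del: index_mult_mat_vec)
        also have "\<dots> = (\<Sum>k=0..<n. 0)"
          unfolding sum_distrib_left sum_subtractf[symmetric]
          by (intro sum.cong refl) (simp add: algebra_simps del: index_mult_mat_vec)
        finally show ?thesis by simp
      qed
    qed
    have "scalar_prod (?M *\<^sub>v v) v = scalar_prod (nc_eval n p Z *\<^sub>v v) v
        - t * scalar_prod (nc_eval n p X *\<^sub>v v) v - (1 - t) * scalar_prod (nc_eval n p Y *\<^sub>v v) v"
    proof -
      have smult: "(c \<cdot>\<^sub>m nc_eval n p U) *\<^sub>v v = c \<cdot>\<^sub>v (nc_eval n p U *\<^sub>v v)" for c U
        using v by (intro eq_vecI) (auto simp: nc_eval_def)
      have car: "nc_eval n p U *\<^sub>v v \<in> carrier_vec n" for U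
        by (rule mult_mat_vec_carrier[OF nc_eval_carrier v])
      have "?M *\<^sub>v v = nc_eval n p Z *\<^sub>v v - t \<cdot>\<^sub>v (nc_eval n p X *\<^sub>v v) - (1 - t) \<cdot>\<^sub>v (nc_eval n p Y *\<^sub>v v)"
        using v by (simp add: minus_mult_distrib_mat_vec[of _ n n] minus_carrier_mat smult)
      then show ?thesis
        using v car by (simp add: minus_scalar_prod_distrib[of _ n] smult_scalar_prod_distrib[OF car v])
    qed
    also have "\<dots> = (\<Sum>w\<in>?K. ?p w * F w)"
      unfolding F_def q_def nc_eval_scalar_prod[OF X v] nc_eval_scalar_prod[OF Y v] nc_eval_scalar_prod[OF Z v]
      unfolding sum_distrib_left sum_subtractf[symmetric]
      by (intro sum.cong refl) (simp add: right_diff_distrib mult.left_commute)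
    also have "\<dots> = (\<Sum>i\<in>UNIV. \<Sum>j\<in>UNIV. ?p [i, j] * F [i, j])"
      by (rule sum_keys_length_two[OF F_short])
    also have "\<dots> = (\<Sum>i\<in>UNIV. \<Sum>j\<in>UNIV. \<Sum>k=0..<n.
        - (t * (1 - t)) * (?p [i, j] * ((?x i k - ?y i k) * (?x j k - ?y j k))))"
      by (simp only: F_two sum_distrib_left mult.left_commute)
    also have "\<dots> = (\<Sum>i\<in>UNIV. \<Sum>k=0..<n. \<Sum>j\<in>UNIV.
        - (t * (1 - t)) * (?p [i, j] * ((?x i k - ?y i k) * (?x j k - ?y j k))))"
      by (intro sum.cong refl sum.swap)
    also have "\<dots> = (\<Sum>k=0..<n. \<Sum>i\<in>UNIV. \<Sum>j\<in>UNIV.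
        - (t * (1 - t)) * (?p [i, j] * ((?x i k - ?y i k) * (?x j k - ?y j k))))"
      by (rule sum.swap)
    also have "\<dots> = - (t * (1 - t)) * (\<Sum>k=0..<n. \<Sum>i\<in>UNIV. \<Sum>j\<in>UNIV.
        ?p [i, j] * ((?x i k - ?y i k) * (?x j k - ?y j k)))"
      by (simp only: sum_distrib_left)
    also have "\<dots> \<ge> 0"
    proof -
      have "(\<Sum>i\<in>UNIV. \<Sum>j\<in>UNIV. ?p [i, j] * ((?x i k - ?y i k) * (?x j k - ?y j k))) \<le> 0" for k
        by (rule neg[of "\<lambda>i. ?x i k - ?y i k"])
      then have "(\<Sum>k=0..<n. \<Sum>i\<in>UNIV. \<Sum>j\<in>UNIV.
          ?p [i, j] * ((?x i k - ?y i k) * (?x j k - ?y j k))) \<le> 0"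
        by (rule sum_nonpos)
      then show ?thesis
        using t by (intro mult_nonpos_nonpos) simp_all
    qed
    finally show ?thesis .
  qed
  then show "pos_semidef n (nc_eval n p (\<lambda>j. t \<cdot>\<^sub>m X j + (1 - t) \<cdot>\<^sub>m Y j)
      - t \<cdot>\<^sub>m nc_eval n p X - (1 - t) \<cdot>\<^sub>m nc_eval n p Y)"
    using M M_sym by (simp add: pos_semidef_def Z_def)
qed

theorem theorem103:
  fixes p :: "('g::finite) ncpoly"
    and \<O> :: "nat \<Rightarrow> ('g \<Rightarrow> real mat) set"
    and \<R> :: "(('g \<Rightarrow> real mat) \<times> real Matrix.vec) set"
  assumes "nc_symmetric p"
    and "nc_basic_open_semialgebraic \<O>"
    and "\<R> = full_rank_points_in p \<O>"
    and "\<R> \<noteq> {}"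
    and "\<forall>P\<in>\<R>. positive_curvature_at p P"
    and "min_degree_defining p \<R>"
  shows "nc_degree p \<le> 2 \<and> nc_concave p"
proof (cases "nc_degree p = 0")
  case True
  then have "Poly_Mapping.lookup p [i, j] = 0" for i j
    using length_le_nc_degree[of "[i, j]" p] by (auto simp: in_keys_iff)
  then show ?thesis using quadratic_nc_concave[OF assms(1)] True by simp
next
  case False
  obtain G where G: "G [] > (0::real)"
    and nonpos: "\<And>\<gamma>. (\<And>i c. nc_degree p \<le> Suc (length c) \<Longrightarrow> \<gamma> i c = 0) \<Longrightarrow>
      (\<Sum>w\<in>Poly_Mapping.keys p. Poly_Mapping.lookup p w * split_form G \<gamma> \<gamma> w) \<le> 0"
    using exists_nonpos_split_form[of \<O> p] assms False by blast
  have deg: "nc_degree p \<le> 2"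
    using nonpos_split_form_degree_le_2[OF assms(1) G nonpos] by blast
  have "nc_concave p"
    using quadratic_nc_concave[OF assms(1) deg] quadratic_coefficients_nonpos[OF deg G nonpos] by blast
  with deg show ?thesis by blast
qed

end
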